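(* Let $\boldsymbol X=(X_1,\dots,X_n)$ be an i.i.d. sample from a density $p_{\theta,\sigma}$, where $\theta$ and $\sigma$ are a location and a scale parameter, respectively. Then the fiducial distribution $h_{\boldsymbol x}(\sigma,\theta)$ for $(\sigma,\theta)$ coincides with the Bayesian posterior obtained with the reference prior $\pi^R_{\sigma,\theta}(\sigma,\theta)\propto1/\sigma$.
   Context: The model is $p_{\theta,\sigma}(x)=\frac1\sigma f\left(\frac{x-\theta}{\sigma}\right)$, $\theta\in\mathbb R$, $\sigma>0$, for a fixed density $f$ on $\mathbb R$, with $n\ge2$ and both parameters unknown. Let $Z_2=X_2-X_1$ and $\boldsymbol Z=(Z_3,\dots,Z_n)$ with $Z_j=(X_j-X_1)/Z_2$, $j=3,\dots,n$; $\boldsymbol Z$ is ancillary for $(\theta,\sigma)$ and the distribution of $Z_2$ does not depend on $\theta$, so that the sampling density of $(X_1,Z_2,\boldsymbol Z)$ factorizes as $p_\sigma(z_2\mid\boldsymbol z)\,p_\theta(x_1\mid z_2,\boldsymbol z;\sigma)\,p(\boldsymbol z)$. The step-by-step fiducial density is $$h_{\boldsymbol x}(\sigma,\theta)=h_{z_2,\boldsymbol z}(\sigma)\,h_{\boldsymbol x}(\theta\mid\sigma),\qquad h_{z_2,\boldsymbol z}(\sigma)=\left|\frac{\partial}{\partial\sigma}F_\sigma(z_2\mid\boldsymbol z)\right|,\qquad h_{\boldsymbol x}(\theta\mid\sigma)=\left|\frac{\partial}{\partial\theta}F_\theta(x_1\mid z_2,\boldsymbol z;\sigma)\right|,$$ where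 $F_\sigma(z_2\mid\boldsymbol z)$ is the conditional distribution function of $Z_2$ given $\boldsymbol Z=\boldsymbol z$, and $F_\theta(x_1\mid z_2,\boldsymbol z;\sigma)$ is that of $X_1$ given $(Z_2,\boldsymbol Z)=(z_2,\boldsymbol z)$ for $\sigma$ known. These one-dimensional conditional distribution functions are assumed to be monotone and differentiable in $\sigma$ and in $\theta$, respectively, and to have limits $0$ and $1$ when the respective parameter tends to the boundaries of its domain. The posterior has density in $(\sigma,\theta)$ proportional to $\frac1\sigma\prod_{i=1}^n p_{\theta,\sigma}(x_i)$.
   Formalization: The assumed limits 0 and 1 of F_σ(z2|z) in σ can never both hold (for σ→∞ it tends to P(Z2≤0|z), strictly between 0 and 1), so h_x is normalized to total mass 1 before it is compared with the posterior; the unnormalized equality is stated only under those limits. *)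

theory Defs
  imports "HOL-Analysis.Analysis"
begin

section \<open>The model and the statistic\<close>

definition is_density :: "(real \<Rightarrow> real) \<Rightarrow> bool" where
  "is_density f \<longleftrightarrow> f \<in> borel_measurable borel \<and> (\<forall>x. 0 \<le> f x) \<and> has_bochner_integral lborel f 1"

definition ls_density :: "(real \<Rightarrow> real) \<Rightarrow> real \<Rightarrow> real \<Rightarrow> real \<Rightarrow> real" where
  "ls_density f \<theta> \<sigma> x = (1 / \<sigma>) * f ((x - \<theta>) / \<sigma>)"

text \<open>The law of \<open>(X\<^sub>1, \<dots>, X\<^sub>n)\<close>; a sample is a function on the index set \<open>{1..n}\<close>.\<close>

definition sample_law :: "(real \<Rightarrow> real) \<Rightarrow> nat \<Rightarrow> real \<Rightarrow> real \<Rightarrow> (nat \<Rightarrow> real) measure" where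
  "sample_law f n \<theta> \<sigma> = PiM {1..n} (\<lambda>_. density lborel (\<lambda>x. ennreal (ls_density f \<theta> \<sigma> x)))"

definition likelihood :: "(real \<Rightarrow> real) \<Rightarrow> nat \<Rightarrow> real \<Rightarrow> real \<Rightarrow> (nat \<Rightarrow> real) \<Rightarrow> real" where
  "likelihood f n \<theta> \<sigma> x = (\<Prod>i\<in>{1..n}. ls_density f \<theta> \<sigma> (x i))"

definition stat_Z2 :: "(nat \<Rightarrow> real) \<Rightarrow> real" where
  "stat_Z2 x = x 2 - x 1"

definition stat_Z :: "nat \<Rightarrow> (nat \<Rightarrow> real) \<Rightarrow> nat \<Rightarrow> real" where
  "stat_Z n x = (\<lambda>j\<in>{3..n}. (x j - x 1) / stat_Z2 x)"

definition sample_of :: "nat \<Rightarrow> real \<Rightarrow> real \<Rightarrow> (nat \<Rightarrow> real) \<Rightarrow> nat \<Rightarrow> real" where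
  "sample_of n x1 z2 z =
     (\<lambda>j\<in>{1..n}. if j = 1 then x1 else if j = 2 then x1 + z2 else x1 + z2 * z j)"

text \<open>The sampling density of \<open>(X\<^sub>1, Z\<^sub>2, Z)\<close>; the factor \<open>\<bar>z2\<bar> ^ (n - 2)\<close> is the Jacobian of
  \<^const>\<open>sample_of\<close>. Lemma \<open>distr_stat\<close> below confirms that it is the density of the image of
  \<^const>\<open>sample_law\<close>.\<close>

definition joint_density ::
  "(real \<Rightarrow> real) \<Rightarrow> nat \<Rightarrow> real \<Rightarrow> real \<Rightarrow> real \<Rightarrow> real \<Rightarrow> (nat \<Rightarrow> real) \<Rightarrow> real" where
  "joint_density f n \<theta> \<sigma> x1 z2 z =
     \<bar>z2\<bar> ^ (n - 2) * likelihood f n \<theta> \<sigma> (sample_of n x1 z2 z)"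


section \<open>Conditional distribution functions\<close>

text \<open>All of these carry both parameters. That \<open>dens_Z2_Z\<close> is free of \<open>\<theta>\<close> and \<open>dens_Z\<close> is free of
  both parameters are facts (lemmas \<open>dens_Z2_Z_location_free\<close> and \<open>dens_Z_ancillary\<close> below), not
  part of the definitions.\<close>

definition dens_Z2_Z ::
  "(real \<Rightarrow> real) \<Rightarrow> nat \<Rightarrow> real \<Rightarrow> real \<Rightarrow> real \<Rightarrow> (nat \<Rightarrow> real) \<Rightarrow> real" where
  "dens_Z2_Z f n \<theta> \<sigma> z2 z = (\<integral>x1. joint_density f n \<theta> \<sigma> x1 z2 z \<partial>lborel)"

definition dens_Z :: "(real \<Rightarrow> real) \<Rightarrow> nat \<Rightarrow> real \<Rightarrow> real \<Rightarrow> (nat \<Rightarrow> real) \<Rightarrow> real" where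
  "dens_Z f n \<theta> \<sigma> z = (\<integral>z2. dens_Z2_Z f n \<theta> \<sigma> z2 z \<partial>lborel)"

definition cond_dens_Z2 ::
  "(real \<Rightarrow> real) \<Rightarrow> nat \<Rightarrow> real \<Rightarrow> real \<Rightarrow> real \<Rightarrow> (nat \<Rightarrow> real) \<Rightarrow> real" where
  "cond_dens_Z2 f n \<theta> \<sigma> z2 z = dens_Z2_Z f n \<theta> \<sigma> z2 z / dens_Z f n \<theta> \<sigma> z"

definition cond_dens_X1 ::
  "(real \<Rightarrow> real) \<Rightarrow> nat \<Rightarrow> real \<Rightarrow> real \<Rightarrow> real \<Rightarrow> real \<Rightarrow> (nat \<Rightarrow> real) \<Rightarrow> real" where
  "cond_dens_X1 f n \<theta> \<sigma> x1 z2 z = joint_density f n \<theta> \<sigma> x1 z2 z / dens_Z2_Z f n \<theta> \<sigma> z2 z"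

definition cond_cdf_Z2 ::
  "(real \<Rightarrow> real) \<Rightarrow> nat \<Rightarrow> real \<Rightarrow> real \<Rightarrow> real \<Rightarrow> (nat \<Rightarrow> real) \<Rightarrow> real" where
  "cond_cdf_Z2 f n \<theta> \<sigma> z2 z = (LINT t:{..z2}|lborel. cond_dens_Z2 f n \<theta> \<sigma> t z)"

definition cond_cdf_X1 ::
  "(real \<Rightarrow> real) \<Rightarrow> nat \<Rightarrow> real \<Rightarrow> real \<Rightarrow> real \<Rightarrow> real \<Rightarrow> (nat \<Rightarrow> real) \<Rightarrow> real" where
  "cond_cdf_X1 f n \<theta> \<sigma> x1 z2 z = (LINT t:{..x1}|lborel. cond_dens_X1 f n \<theta> \<sigma> t z2 z)"

text \<open>The same distribution functions at the statistics of the observed sample.\<close>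

definition F_sigma :: "(real \<Rightarrow> real) \<Rightarrow> nat \<Rightarrow> (nat \<Rightarrow> real) \<Rightarrow> real \<Rightarrow> real \<Rightarrow> real" where
  "F_sigma f n x \<theta> \<sigma> = cond_cdf_Z2 f n \<theta> \<sigma> (stat_Z2 x) (stat_Z n x)"

definition F_theta :: "(real \<Rightarrow> real) \<Rightarrow> nat \<Rightarrow> (nat \<Rightarrow> real) \<Rightarrow> real \<Rightarrow> real \<Rightarrow> real" where
  "F_theta f n x \<sigma> \<theta> = cond_cdf_X1 f n \<theta> \<sigma> (x 1) (stat_Z2 x) (stat_Z n x)"

definition monotone_differentiable_on :: "real set \<Rightarrow> (real \<Rightarrow> real) \<Rightarrow> bool" where
  "monotone_differentiable_on S F \<longleftrightarrow>
     (mono_on S F \<or> antimono_on S F) \<and> (\<forall>t\<in>S. F differentiable (at t))"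

definition limits_zero_one :: "real filter \<Rightarrow> real filter \<Rightarrow> (real \<Rightarrow> real) \<Rightarrow> bool" where
  "limits_zero_one A B F \<longleftrightarrow>
     (F \<longlongrightarrow> 0) A \<and> (F \<longlongrightarrow> 1) B \<or> (F \<longlongrightarrow> 1) A \<and> (F \<longlongrightarrow> 0) B"


section \<open>Fiducial and posterior distributions\<close>

definition fiducial_density :: "(real \<Rightarrow> real) \<Rightarrow> nat \<Rightarrow> (nat \<Rightarrow> real) \<Rightarrow> real \<Rightarrow> real \<Rightarrow> real" where
  "fiducial_density f n x \<sigma> \<theta> =
     \<bar>deriv (\<lambda>s. F_sigma f n x \<theta> s) \<sigma>\<bar> * \<bar>deriv (\<lambda>t. F_theta f n x \<sigma> t) \<theta>\<bar>"

definition reference_prior :: "real \<Rightarrow> real \<Rightarrow> real" where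
  "reference_prior \<sigma> \<theta> = 1 / \<sigma>"

definition param_measure :: "(real \<Rightarrow> real \<Rightarrow> real) \<Rightarrow> (real \<times> real) measure" where
  "param_measure h =
     density lborel (\<lambda>(\<sigma>, \<theta>). indicator {0<..} \<sigma> * ennreal (h \<sigma> \<theta>))"

definition normalize_measure :: "'a measure \<Rightarrow> 'a measure" where
  "normalize_measure M = scale_measure (inverse (emeasure M (space M))) M"

text \<open>The first step leaves the sign of \<open>Z\<^sub>2\<close> free, so \<open>F\<^sub>\<sigma>(z2 | z)\<close> tends, as \<open>\<sigma>\<close> grows, to the
  conditional probability of \<open>Z\<^sub>2 \<le> 0\<close> rather than to 0 or 1 (for symmetric \<open>f\<close> to 1/2), and the
  step-by-step fiducial density need not integrate to 1. The fiducial distribution is therefore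
  normalized; when the limits are 0 and 1 the normalization does nothing.\<close>

definition fiducial_distribution ::
  "(real \<Rightarrow> real) \<Rightarrow> nat \<Rightarrow> (nat \<Rightarrow> real) \<Rightarrow> (real \<times> real) measure" where
  "fiducial_distribution f n x = normalize_measure (param_measure (fiducial_density f n x))"

definition reference_posterior ::
  "(real \<Rightarrow> real) \<Rightarrow> nat \<Rightarrow> (nat \<Rightarrow> real) \<Rightarrow> (real \<times> real) measure" where
  "reference_posterior f n x =
     normalize_measure
       (param_measure (\<lambda>\<sigma> \<theta>. reference_prior \<sigma> \<theta> * likelihood f n \<theta> \<sigma> x))"


section \<open>Distribution of the statistic\<close>

lemma nn_integral_PiM_density:
  fixes p :: "real \<Rightarrow> real"
  assumes "finite I" and p[measurable]: "p \<in> borel_measurable borel" and nn: "\<And>x. 0 \<le> p x"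
    and int: "integrable lborel p"
    and g: "g \<in> borel_measurable (PiM I (\<lambda>_::nat. lborel))"
  shows "(\<integral>\<^sup>+x. g x \<partial>PiM I (\<lambda>_. density lborel (\<lambda>x. ennreal (p x)))) =
         (\<integral>\<^sup>+x. (\<Prod>i\<in>I. ennreal (p (x i))) * g x \<partial>PiM I (\<lambda>_. lborel))"
  using assms(1) g
proof (induction I arbitrary: g rule: finite_induct)
  case empty
  then show ?case by (simp add: PiM_empty nn_integral_count_space_finite)
next
  case (insert i I)
  interpret L: product_sigma_finite "\<lambda>_::nat. lborel :: real measure" ..
  interpret P: product_sigma_finite "\<lambda>_::nat. density lborel (\<lambda>x. ennreal (p x))"
    by standard
      (intro sigma_finite_measure.sigma_finite_countable finite_measure.axioms(1) finite_measureI,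
       use int nn in \<open>simp add: emeasure_density nn_integral_eq_integral\<close>)
  note [measurable] = insert.prems
  have eqs: "sets (PiM (insert i I) (\<lambda>_::nat. density lborel (\<lambda>x. ennreal (p x)))) =
        sets (PiM (insert i I) (\<lambda>_. lborel))" for I and i :: nat
    by (intro sets_PiM_cong) auto
  have [measurable]: "g \<in> borel_measurable (PiM (insert i I) (\<lambda>_. density lborel (\<lambda>x. ennreal (p x))))"
    using insert.prems by (simp cong: measurable_cong_sets add: measurable_cong_sets[OF eqs refl])
  have [measurable]: "(\<lambda>(x, y). x(i := y)) \<in> PiM I (\<lambda>_. lborel) \<Otimes>\<^sub>M lborel \<rightarrow>\<^sub>M PiM (insert i I) (\<lambda>_. lborel :: real measure)"
    by (auto intro!: measurable_fun_upd simp: case_prod_beta)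
  have upd: "x(i := y) \<in> space (PiM (insert i I) (\<lambda>_. lborel :: real measure))"
    if "x \<in> space (PiM I (\<lambda>_. lborel :: real measure))" for x y
    using that by (auto simp: space_PiM PiE_def extensional_def)
  have "(\<integral>\<^sup>+x. g x \<partial>PiM (insert i I) (\<lambda>_. density lborel (\<lambda>x. ennreal (p x)))) =
     (\<integral>\<^sup>+x. \<integral>\<^sup>+y. g (x(i := y)) \<partial>density lborel (\<lambda>x. ennreal (p x)) \<partial>PiM I (\<lambda>_. density lborel (\<lambda>x. ennreal (p x))))"
    by (rule P.product_nn_integral_insert) (use insert in auto)
  also have "\<dots> = (\<integral>\<^sup>+x. (\<Prod>j\<in>I. ennreal (p (x j))) * (\<integral>\<^sup>+y. g (x(i := y)) \<partial>density lborel (\<lambda>x. ennreal (p x))) \<partial>PiM I (\<lambda>_. lborel))"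
  proof (rule insert.IH)
    interpret d: sigma_finite_measure "density lborel (\<lambda>x. ennreal (p x))"
      using P.sigma_finite_measures by blast
    show "(\<lambda>x. \<integral>\<^sup>+y. g (x(i := y)) \<partial>density lborel (\<lambda>x. ennreal (p x))) \<in> borel_measurable (PiM I (\<lambda>_. lborel))"
      by measurable
  qed
  also have "\<dots> = (\<integral>\<^sup>+x. \<integral>\<^sup>+y. (\<Prod>j\<in>insert i I. ennreal (p ((x(i := y)) j))) * g (x(i := y)) \<partial>lborel \<partial>PiM I (\<lambda>_. lborel))"
  proof (rule nn_integral_cong)
    fix x assume x[measurable]: "x \<in> space (PiM I (\<lambda>_. lborel :: real measure))"
    have [measurable]: "(\<lambda>y. x(i := y)) \<in> lborel \<rightarrow>\<^sub>M PiM (insert i I) (\<lambda>_. lborel :: real measure)"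
      using x by measurable
    have [measurable]: "(\<lambda>y. g (x(i := y))) \<in> borel_measurable borel"
      using measurable_compose[OF \<open>(\<lambda>y. x(i := y)) \<in> _\<close> insert.prems] by simp
    have pr: "(\<Prod>j\<in>I. ennreal (p (if j = i then y else x j))) = (\<Prod>j\<in>I. ennreal (p (x j)))" for y
      using insert.hyps by (intro prod.cong) auto
    show "(\<Prod>j\<in>I. ennreal (p (x j))) * (\<integral>\<^sup>+y. g (x(i := y)) \<partial>density lborel (\<lambda>x. ennreal (p x))) =
      (\<integral>\<^sup>+y. (\<Prod>j\<in>insert i I. ennreal (p ((x(i := y)) j))) * g (x(i := y)) \<partial>lborel)"
      using insert.hyps
      by (simp add: nn_integral_density pr nn_integral_cmult[symmetric] mult_ac)
  qed
  also have "\<dots> = (\<integral>\<^sup>+x. (\<Prod>j\<in>insert i I. ennreal (p (x j))) * g x \<partial>PiM (insert i I) (\<lambda>_. lborel))"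
    by (rule L.product_nn_integral_insert[symmetric]) (use insert in auto)
  finally show ?case .
qed

lemma nn_integral_PiM_affine:
  fixes b c :: real
  assumes "finite I" and c: "c \<noteq> 0" and g: "g \<in> borel_measurable (PiM I (\<lambda>_::nat. lborel))"
  shows "(\<integral>\<^sup>+x. g x \<partial>PiM I (\<lambda>_. lborel)) =
         ennreal (\<bar>c\<bar> ^ card I) * (\<integral>\<^sup>+z. g (\<lambda>j\<in>I. b + c * z j) \<partial>PiM I (\<lambda>_. lborel))"
  using assms(1) g
proof (induction I arbitrary: g rule: finite_induct)
  case empty
  then show ?case by (simp add: PiM_empty nn_integral_count_space_finite restrict_def)
next
  case (insert i I)
  interpret L: product_sigma_finite "\<lambda>_::nat. lborel :: real measure" ..
  note [measurable] = insert.prems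
  have [measurable]: "(\<lambda>(x, y). x(i := y)) \<in> PiM I (\<lambda>_. lborel) \<Otimes>\<^sub>M lborel \<rightarrow>\<^sub>M PiM (insert i I) (\<lambda>_. lborel :: real measure)"
    by (auto intro!: measurable_fun_upd simp: case_prod_beta)
  have upd: "(\<lambda>j\<in>I. b + c * z j)(i := b + c * y) = (\<lambda>j\<in>insert i I. b + c * (z(i := y)) j)" for z y
    using insert.hyps by (auto simp: restrict_def)
  have "(\<integral>\<^sup>+x. g x \<partial>PiM (insert i I) (\<lambda>_. lborel)) = (\<integral>\<^sup>+x. \<integral>\<^sup>+y. g (x(i := y)) \<partial>lborel \<partial>PiM I (\<lambda>_. lborel))"
    by (rule L.product_nn_integral_insert) (use insert in auto)
  also have "\<dots> = ennreal (\<bar>c\<bar> ^ card I) * (\<integral>\<^sup>+z. \<integral>\<^sup>+y. g ((\<lambda>j\<in>I. b + c * z j)(i := y)) \<partial>lborel \<partial>PiM I (\<lambda>_. lborel))"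
    by (rule insert.IH) measurable
  also have "(\<integral>\<^sup>+z. \<integral>\<^sup>+y. g ((\<lambda>j\<in>I. b + c * z j)(i := y)) \<partial>lborel \<partial>PiM I (\<lambda>_. lborel)) =
     (\<integral>\<^sup>+z. ennreal \<bar>c\<bar> * (\<integral>\<^sup>+y. g (\<lambda>j\<in>insert i I. b + c * (z(i := y)) j) \<partial>lborel) \<partial>PiM I (\<lambda>_. lborel))"
  proof (rule nn_integral_cong)
    fix z assume z: "z \<in> space (PiM I (\<lambda>_. lborel :: real measure))"
    have "(\<lambda>j\<in>I. b + c * z j) \<in> space (PiM I (\<lambda>_. lborel :: real measure))"
      by (auto simp: space_PiM)
    then have "(\<lambda>y. (\<lambda>j\<in>I. b + c * z j)(i := y)) \<in> lborel \<rightarrow>\<^sub>M PiM (insert i I) (\<lambda>_. lborel :: real measure)"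
      by measurable
    from measurable_compose[OF this insert.prems]
    have "(\<lambda>y. g ((\<lambda>j\<in>I. b + c * z j)(i := y))) \<in> borel_measurable borel" by simp
    from nn_integral_real_affine[OF this c, of b]
    show "(\<integral>\<^sup>+y. g ((\<lambda>j\<in>I. b + c * z j)(i := y)) \<partial>lborel) =
       ennreal \<bar>c\<bar> * (\<integral>\<^sup>+y. g (\<lambda>j\<in>insert i I. b + c * (z(i := y)) j) \<partial>lborel)"
      by (simp only: upd)
  qed
  also have "\<dots> = ennreal \<bar>c\<bar> * (\<integral>\<^sup>+z. \<integral>\<^sup>+y. g (\<lambda>j\<in>insert i I. b + c * (z(i := y)) j) \<partial>lborel \<partial>PiM I (\<lambda>_. lborel))"
    by (rule nn_integral_cmult) measurable
  also have "(\<integral>\<^sup>+z. \<integral>\<^sup>+y. g (\<lambda>j\<in>insert i I. b + c * (z(i := y)) j) \<partial>lborel \<partial>PiM I (\<lambda>_. lborel)) =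
     (\<integral>\<^sup>+z. g (\<lambda>j\<in>insert i I. b + c * z j) \<partial>PiM (insert i I) (\<lambda>_. lborel))"
    by (rule L.product_nn_integral_insert[symmetric]) (use insert in measurable)
  also have "ennreal (\<bar>c\<bar> ^ card I) * (ennreal \<bar>c\<bar> * r) = ennreal (\<bar>c\<bar> ^ card (insert i I)) * r" for r
    using insert.hyps by (simp add: ennreal_mult' mult_ac)
  finally show ?case .
qed

lemma ls_density_props:
  assumes "is_density f" "0 < \<sigma>"
  shows "ls_density f \<theta> \<sigma> \<in> borel_measurable borel" "0 \<le> ls_density f \<theta> \<sigma> x"
    "integrable lborel (ls_density f \<theta> \<sigma>)"
proof -
  have [measurable]: "f \<in> borel_measurable borel" and f0: "\<And>x. 0 \<le> f x" and fi: "integrable lborel f"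
    using assms by (auto simp: is_density_def has_bochner_integral_iff)
  show "ls_density f \<theta> \<sigma> \<in> borel_measurable borel"
    unfolding ls_density_def[abs_def] by measurable
  show "0 \<le> ls_density f \<theta> \<sigma> x"
    using assms f0 by (simp add: ls_density_def)
  have "integrable lborel (\<lambda>x. f (- \<theta> / \<sigma> + (1 / \<sigma>) * x))"
    using fi assms(2) by (intro lborel_integrable_real_affine) auto
  then have "integrable lborel (\<lambda>x. (1 / \<sigma>) * f (- \<theta> / \<sigma> + (1 / \<sigma>) * x))"
    by (rule integrable_mult_right)
  then show "integrable lborel (ls_density f \<theta> \<sigma>)"
    by (simp add: ls_density_def[abs_def] diff_divide_distrib)
qed

lemma atLeastAtMost_split: "2 \<le> n \<Longrightarrow> {1..n} = insert 1 (insert 2 {3..n::nat})"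
  by auto

lemma distr_stat:
  assumes f: "is_density f" and \<sigma>: "0 < \<sigma>" and n: "2 \<le> n"
  shows "distr (sample_law f n \<theta> \<sigma>) (lborel \<Otimes>\<^sub>M (lborel \<Otimes>\<^sub>M PiM {3..n} (\<lambda>_. lborel)))
           (\<lambda>x. (x 1, stat_Z2 x, stat_Z n x)) =
         density (lborel \<Otimes>\<^sub>M (lborel \<Otimes>\<^sub>M PiM {3..n} (\<lambda>_. lborel)))
           (\<lambda>(x1, z2, z). ennreal (joint_density f n \<theta> \<sigma> x1 z2 z))"
    (is "distr ?S ?M ?T = density ?M ?q")
proof (rule measure_eqI)
  interpret L: product_sigma_finite "\<lambda>_::nat. lborel :: real measure" ..
  let ?P = "\<lambda>I. PiM I (\<lambda>_::nat. lborel :: real measure)"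
  let ?J = "{3..n}"
  define p where "p = ls_density f \<theta> \<sigma>"
  have p[measurable]: "p \<in> borel_measurable borel" and p0: "\<And>x. 0 \<le> p x" and pi: "integrable lborel p"
    using ls_density_props[OF f \<sigma>] by (auto simp: p_def)
  interpret J: sigma_finite_measure "?P ?J"
    by (rule L.sigma_finite) simp
  interpret LJ: pair_sigma_finite "lborel :: real measure" "?P ?J" ..
  have sf: "sigma_finite_measure ((lborel :: real measure) \<Otimes>\<^sub>M ?P ?J)"
    by (rule sigma_finite_pair_measure[OF lborel.sigma_finite_measure_axioms J.sigma_finite_measure_axioms])
  have setsS: "sets ?S = sets (?P {1..n})"
    unfolding sample_law_def by (intro sets_PiM_cong) auto
  have comp: "(\<lambda>x. x i) \<in> ?P {1..n} \<rightarrow>\<^sub>M (borel :: real measure)" if "i \<in> {1..n}" for i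
    using measurable_component_singleton[OF that, of "\<lambda>_. lborel :: real measure"] by simp
  have T0[measurable]: "?T \<in> ?P {1..n} \<rightarrow>\<^sub>M ?M"
  proof -
    have [measurable]: "stat_Z2 \<in> ?P {1..n} \<rightarrow>\<^sub>M lborel"
      using n comp[of 1] comp[of 2] unfolding stat_Z2_def[abs_def] by simp
    have [measurable]: "(\<lambda>x. x 1) \<in> ?P {1..n} \<rightarrow>\<^sub>M lborel"
      using n comp[of 1] by simp
    have [measurable]: "stat_Z n \<in> ?P {1..n} \<rightarrow>\<^sub>M ?P ?J"
      unfolding stat_Z_def[abs_def]
    proof (rule measurable_restrict)
      fix j assume "j \<in> ?J"
      then show "(\<lambda>x. (x j - x 1) / stat_Z2 x) \<in> ?P {1..n} \<rightarrow>\<^sub>M lborel"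
        using borel_measurable_divide[OF borel_measurable_diff[OF comp[of j] comp[of 1]], of stat_Z2]
          \<open>stat_Z2 \<in> _\<close> by simp
    qed
    show ?thesis by measurable
  qed
  then have T: "?T \<in> ?S \<rightarrow>\<^sub>M ?M"
    by (simp add: measurable_cong_sets[OF setsS refl])
  show "sets (distr ?S ?M ?T) = sets (density ?M ?q)" by simp
  have joint: "joint_density f n \<theta> \<sigma> x1 z2 z =
      \<bar>z2\<bar> ^ (n - 2) * (p x1 * (p (x1 + z2) * (\<Prod>j\<in>?J. p (x1 + z2 * z j))))" for x1 z2 z
    unfolding joint_density_def likelihood_def p_def
    by (subst atLeastAtMost_split[OF n], subst prod.insert, simp, simp, subst prod.insert, simp, simp)
       (use n in \<open>auto simp: sample_of_def intro!: prod.cong\<close>)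
  have joint_ennreal: "ennreal (joint_density f n \<theta> \<sigma> x1 z2 z) =
      ennreal (\<bar>z2\<bar> ^ (n - 2)) * (ennreal (p x1) * (ennreal (p (x1 + z2)) * (\<Prod>j\<in>?J. ennreal (p (x1 + z2 * z j)))))" for x1 z2 z
    unfolding joint by (simp add: ennreal_mult p0 prod_nonneg prod_ennreal)
  have q[measurable]: "?q \<in> borel_measurable ?M"
    unfolding joint by measurable
  fix A assume "A \<in> sets (distr ?S ?M ?T)"
  then have A[measurable]: "A \<in> sets ?M" by simp
  define G where "G x = (\<Prod>i\<in>{1..n}. ennreal (p (x i))) * indicator A (?T x)" for x
  have G[measurable]: "G \<in> borel_measurable (?P {1..n})"
    unfolding G_def[abs_def] by measurable
  have "emeasure (distr ?S ?M ?T) A = (\<integral>\<^sup>+x. indicator A (?T x) \<partial>?S)"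
    using nn_integral_distr[OF T, of "indicator A"] A nn_integral_indicator[of A "distr ?S ?M ?T"]
    by simp
  also have "\<dots> = (\<integral>\<^sup>+x. G x \<partial>?P {1..n})"
    unfolding sample_law_def G_def p_def[symmetric]
    by (rule nn_integral_PiM_density[OF _ p p0 pi measurable_compose[OF T0 borel_measurable_indicator[OF A]]]) simp
  also have "\<dots> = (\<integral>\<^sup>+x1. \<integral>\<^sup>+y. \<integral>\<^sup>+w. G (w(2 := y, 1 := x1)) \<partial>?P ?J \<partial>lborel \<partial>lborel)"
  proof -
    have G': "G \<in> borel_measurable (?P (insert 1 (insert 2 ?J)))"
      using G unfolding atLeastAtMost_split[OF n] .
    have "(\<integral>\<^sup>+x. G x \<partial>?P {1..n}) = (\<integral>\<^sup>+x1. \<integral>\<^sup>+w. G (w(1 := x1)) \<partial>?P (insert 2 ?J) \<partial>lborel)"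
      unfolding atLeastAtMost_split[OF n]
      by (rule L.product_nn_integral_insert_rev) (use G' in auto)
    also have "\<dots> = (\<integral>\<^sup>+x1. \<integral>\<^sup>+y. \<integral>\<^sup>+w. G (w(2 := y, 1 := x1)) \<partial>?P ?J \<partial>lborel \<partial>lborel)"
    proof (rule nn_integral_cong)
      fix x1 :: real
      have "(\<lambda>w. w(1 := x1)) \<in> ?P (insert 2 ?J) \<rightarrow>\<^sub>M ?P (insert 1 (insert 2 ?J))"
        by (intro measurable_fun_upd[where J="insert 2 ?J"]) auto
      from measurable_compose[OF this G']
      show "(\<integral>\<^sup>+w. G (w(1 := x1)) \<partial>?P (insert 2 ?J)) = (\<integral>\<^sup>+y. \<integral>\<^sup>+w. G (w(2 := y, 1 := x1)) \<partial>?P ?J \<partial>lborel)"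
        by (intro L.product_nn_integral_insert_rev) auto
    qed
    finally show ?thesis .
  qed
  also have "\<dots> = (\<integral>\<^sup>+x1. \<integral>\<^sup>+z2. \<integral>\<^sup>+z. ?q (x1, z2, z) * indicator A (x1, z2, z) \<partial>?P ?J \<partial>lborel \<partial>lborel)"
  proof (rule nn_integral_cong)
    fix x1 :: real
    have "(\<lambda>u. (snd u)(2 := fst u, 1 := x1)) \<in> lborel \<Otimes>\<^sub>M ?P ?J \<rightarrow>\<^sub>M ?P (insert 1 (insert 2 ?J))"
      by (intro measurable_fun_upd[where J="insert 2 ?J"] measurable_fun_upd[where J="?J"]) auto
    from measurable_compose[OF this, of G borel] G
    have Gu: "(\<lambda>u. G ((snd u)(2 := fst u, 1 := x1))) \<in> borel_measurable (lborel \<Otimes>\<^sub>M ?P ?J)"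
      unfolding atLeastAtMost_split[OF n] by simp
    then have "(\<lambda>(y, w). G (w(2 := y, 1 := x1))) \<in> borel_measurable (lborel \<Otimes>\<^sub>M ?P ?J)"
      by (simp add: case_prod_beta)
    then have meas: "(\<lambda>y. \<integral>\<^sup>+w. G (w(2 := y, 1 := x1)) \<partial>?P ?J) \<in> borel_measurable borel"
      using J.borel_measurable_nn_integral by fastforce
    have "(\<integral>\<^sup>+y. \<integral>\<^sup>+w. G (w(2 := y, 1 := x1)) \<partial>?P ?J \<partial>lborel) =
        (\<integral>\<^sup>+z2. \<integral>\<^sup>+w. G (w(2 := x1 + z2, 1 := x1)) \<partial>?P ?J \<partial>lborel)"
      using nn_integral_real_affine[OF meas, of 1 x1] by simp
    also have "\<dots> = (\<integral>\<^sup>+z2. \<integral>\<^sup>+z. ?q (x1, z2, z) * indicator A (x1, z2, z) \<partial>?P ?J \<partial>lborel)"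
    proof (rule nn_integral_cong_AE, use AE_lborel_singleton[of "0::real"] in eventually_elim)
      fix z2 :: real
      assume z2: "z2 \<noteq> 0"
      have "(\<lambda>w. w(2 := x1 + z2, 1 := x1)) \<in> ?P ?J \<rightarrow>\<^sub>M ?P (insert 1 (insert 2 ?J))"
        by (intro measurable_fun_upd[where J="insert 2 ?J"] measurable_fun_upd[where J="?J"]) auto
      from measurable_compose[OF this, of G borel] G
      have mG: "(\<lambda>w. G (w(2 := x1 + z2, 1 := x1))) \<in> borel_measurable (?P ?J)"
        unfolding atLeastAtMost_split[OF n] by simp
      have aff: "(\<lambda>z. \<lambda>j\<in>?J. x1 + z2 * z j) \<in> ?P ?J \<rightarrow>\<^sub>M ?P ?J"
      proof (rule measurable_restrict)
        fix j assume "j \<in> ?J"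
        then have "(\<lambda>z. z j) \<in> ?P ?J \<rightarrow>\<^sub>M (borel :: real measure)"
          using measurable_component_singleton[of j ?J "\<lambda>_. lborel :: real measure"] by simp
        then show "(\<lambda>z. x1 + z2 * z j) \<in> ?P ?J \<rightarrow>\<^sub>M lborel"
          using borel_measurable_add[OF borel_measurable_const borel_measurable_times[OF borel_measurable_const]]
          by simp
      qed
      have "(\<integral>\<^sup>+w. G (w(2 := x1 + z2, 1 := x1)) \<partial>?P ?J) =
          ennreal (\<bar>z2\<bar> ^ card ?J) * (\<integral>\<^sup>+z. G ((\<lambda>j\<in>?J. x1 + z2 * z j)(2 := x1 + z2, 1 := x1)) \<partial>?P ?J)"
        by (rule nn_integral_PiM_affine[OF _ z2 mG]) simp
      also have "\<dots> = (\<integral>\<^sup>+z. ennreal (\<bar>z2\<bar> ^ card ?J) * G ((\<lambda>j\<in>?J. x1 + z2 * z j)(2 := x1 + z2, 1 := x1)) \<partial>?P ?J)"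
        by (rule nn_integral_cmult[symmetric]) (use measurable_compose[OF aff mG] in simp)
      also have "\<dots> = (\<integral>\<^sup>+z. ?q (x1, z2, z) * indicator A (x1, z2, z) \<partial>?P ?J)"
      proof (rule nn_integral_cong)
        fix z assume "z \<in> space (?P ?J)"
        then have z: "z \<in> extensional ?J" by (auto simp: space_PiM PiE_def)
        let ?x = "(\<lambda>j\<in>?J. x1 + z2 * z j)(2 := x1 + z2, 1 := x1)"
        have "stat_Z n ?x = z"
          using z z2 by (auto simp: stat_Z_def stat_Z2_def fun_eq_iff extensional_def)
        moreover have "(\<Prod>i\<in>{1..n}. ennreal (p (?x i))) =
            ennreal (p x1) * (ennreal (p (x1 + z2)) * (\<Prod>j\<in>?J. ennreal (p (x1 + z2 * z j))))"
          by (subst atLeastAtMost_split[OF n], subst prod.insert, simp, simp, subst prod.insert, simp, simp)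
             (auto intro!: arg_cong2[of _ _ _ _ "(*)"] prod.cong)
        ultimately show "ennreal (\<bar>z2\<bar> ^ card ?J) * G ?x = ?q (x1, z2, z) * indicator A (x1, z2, z)"
          by (simp add: G_def joint_ennreal stat_Z2_def mult_ac)
      qed
      finally show "(\<integral>\<^sup>+w. G (w(2 := x1 + z2, 1 := x1)) \<partial>?P ?J) =
          (\<integral>\<^sup>+z. ?q (x1, z2, z) * indicator A (x1, z2, z) \<partial>?P ?J)" .
    qed
    finally show "(\<integral>\<^sup>+y. \<integral>\<^sup>+w. G (w(2 := y, 1 := x1)) \<partial>?P ?J \<partial>lborel) =
        (\<integral>\<^sup>+z2. \<integral>\<^sup>+z. ?q (x1, z2, z) * indicator A (x1, z2, z) \<partial>?P ?J \<partial>lborel)" .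
  qed
  also have "\<dots> = (\<integral>\<^sup>+u. ?q u * indicator A u \<partial>?M)"
  proof -
    have qA: "(\<lambda>u. ?q u * indicator A u) \<in> borel_measurable ?M" by measurable
    show ?thesis
      by (subst sigma_finite_measure.nn_integral_fst[OF sf qA, symmetric], rule nn_integral_cong,
          rule J.nn_integral_fst) (use measurable_compose[OF measurable_Pair1' qA] in auto)
  qed
  also have "\<dots> = emeasure (density ?M ?q) A"
    using q A by (simp add: emeasure_density)
  finally show "emeasure (distr ?S ?M ?T) A = emeasure (density ?M ?q) A" .
qed

lemma dens_Z2_Z_location_free: "dens_Z2_Z f n \<theta> \<sigma> z2 z = dens_Z2_Z f n 0 \<sigma> z2 z"
proof -
  have "joint_density f n \<theta> \<sigma> (\<theta> + 1 * x1) z2 z = joint_density f n 0 \<sigma> x1 z2 z" for x1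
    unfolding joint_density_def likelihood_def
    by (intro arg_cong2[of _ _ _ _ "(*)"] prod.cong)
       (auto simp: sample_of_def ls_density_def algebra_simps)
  then show ?thesis
    unfolding dens_Z2_Z_def by (subst lborel_integral_real_affine[of 1 _ \<theta>]) auto
qed

lemma dens_Z_ancillary:
  assumes \<sigma>: "0 < \<sigma>" and n: "2 \<le> n"
  shows "dens_Z f n \<theta> \<sigma> z = dens_Z f n 0 1 z"
proof -
  have scale: "joint_density f n 0 \<sigma> (0 + \<sigma> * x1) (0 + \<sigma> * z2) z = (1 / \<sigma>\<^sup>2) * joint_density f n 0 1 x1 z2 z"
    for x1 z2
  proof -
    have "likelihood f n 0 \<sigma> (sample_of n (\<sigma> * x1) (\<sigma> * z2) z) =
        (\<Prod>i\<in>{1..n}. (1 / \<sigma>) * ls_density f 0 1 (sample_of n x1 z2 z i))"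
      unfolding likelihood_def
      using \<sigma> by (intro prod.cong) (auto simp: sample_of_def ls_density_def add_divide_distrib)
    also have "\<dots> = (1 / \<sigma>) ^ n * likelihood f n 0 1 (sample_of n x1 z2 z)"
      by (simp only: prod.distrib likelihood_def prod_constant) simp
    finally have *: "likelihood f n 0 \<sigma> (sample_of n (\<sigma> * x1) (\<sigma> * z2) z) = \<dots>" .
    have "\<sigma> ^ n = \<sigma> ^ (n - 2) * \<sigma>\<^sup>2"
      using n by (metis le_add_diff_inverse2 power_add)
    then show ?thesis
      using \<sigma> by (simp add: joint_density_def * abs_mult power_mult_distrib power_one_over field_simps)
  qed
  have "dens_Z2_Z f n 0 \<sigma> (0 + \<sigma> * z2) z = (1 / \<sigma>) * dens_Z2_Z f n 0 1 z2 z" for z2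
    unfolding dens_Z2_Z_def using \<sigma>
    by (subst lborel_integral_real_affine[of \<sigma> _ 0], simp, subst scale) (simp add: power2_eq_square)
  then have "dens_Z f n 0 \<sigma> z = dens_Z f n 0 1 z"
    unfolding dens_Z_def using \<sigma>
    by (subst lborel_integral_real_affine[of \<sigma> _ 0]) auto
  then show ?thesis
    by (simp add: dens_Z_def dens_Z2_Z_location_free[of f n \<theta>])
qed

end

theory Submission
  imports Defs
begin

text \<open>Write \<open>z2 = x 2 - x 1\<close>, let \<open>z\<close> be the observed ratios, and let \<open>g (u, v)\<close> be the density of
  \<open>(X\<^sub>1, Z\<^sub>2, Z)\<close> at \<open>(u, v, z)\<close> for \<open>\<theta> = 0\<close> and \<open>\<sigma> = 1\<close>. Put \<open>m v = \<integral>g (u, v) du\<close> and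
  \<open>c = \<integral>m v dv\<close>. Because the model is a location-scale family, both conditional distribution
  functions are pivotal (\<open>cond_cdf_Z2_pivot\<close>, \<open>cond_cdf_X1_pivot\<close>): as functions of the parameter,
  \<open>F\<^sub>\<sigma>\<close> is \<open>1 / c\<close> times the integral of \<open>m\<close> up to \<open>z2 / \<sigma>\<close>, and \<open>F\<^sub>\<theta>\<close> is \<open>1 / m (z2 / \<sigma>)\<close>
  times the integral of \<open>g (\<sqdot>, z2 / \<sigma>)\<close> up to \<open>(x 1 - \<theta>) / \<sigma>\<close>. Differentiating,
  the product of the absolute derivatives is
  \<open>\<bar>z2\<bar> / (c \<sigma>\<^sup>2) * m (z2 / \<sigma>) * g ((x 1 - \<theta>) / \<sigma>, z2 / \<sigma>) / (\<sigma> m (z2 / \<sigma>))\<close>.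
  The factor \<open>m (z2 / \<sigma>)\<close> cancels, and \<open>g ((x 1 - \<theta>) / \<sigma>, z2 / \<sigma>)\<close> is \<open>\<sigma>\<^sup>2 \<bar>z2\<bar> ^ (n - 2)\<close> times the
  likelihood. Hence the fiducial density is \<open>\<bar>z2\<bar> ^ (n - 1) / c\<close>, a constant, times \<open>1 / \<sigma>\<close> times the
  likelihood (\<open>AE_fiducial_density\<close>), and normalization removes the constant.

  The density \<open>f\<close> is only measurable, so differentiating an integral returns the integrand almost
  everywhere at best. Since the distribution functions are differentiable throughout, this follows
  from the fundamental theorem of calculus for derivatives of constant sign
  (\<open>AE_deriv_indefinite_integral\<close>); the exceptional null sets are carried from pivots to parameters
  by \<open>AE_lborel_transport\<close> and combined by Fubini's theorem, which needs the joint measurability of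
  the fiducial density (\<open>borel_measurable_fiducial_density\<close>).

  When the distribution functions have limits 0 and 1, each absolute derivative integrates to 1
  (\<open>nn_integral_abs_deriv_eq_1\<close>), so the fiducial density is a probability density before any
  normalization.\<close>

section \<open>Derivatives of monotone functions\<close>

text \<open>The derivative at a point is the limit of the difference quotients with step \<open>1 / (k + 1)\<close>,
  each of which is jointly measurable in the parameter and the point. The fiducial density needs
  the joint form, because a density on the plane is meaningful only if it is measurable there.\<close>

lemma borel_measurable_deriv_param:
  fixes F :: "real \<Rightarrow> real \<Rightarrow> real"
  assumes F: "(\<lambda>(a, t). F a t) \<in> borel_measurable borel"
    and A: "A \<in> sets borel"
    and diff: "\<And>a t. (a, t) \<in> A \<Longrightarrow> F a differentiable (at t)"
  shows "(\<lambda>(a, t). indicator A (a, t) * deriv (F a) t) \<in> borel_measurable borel"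
proof (rule borel_measurable_LIMSEQ_real)
  note [measurable] = A
  have [measurable]: "(fst :: real \<times> real \<Rightarrow> real) \<in> borel_measurable borel" "(snd :: real \<times> real \<Rightarrow> real) \<in> borel_measurable borel"
    by (auto intro!: borel_measurable_continuous_onI continuous_intros)
  have [measurable]: "(\<lambda>p. F (g p) (h p)) \<in> borel_measurable borel"
    if "g \<in> borel_measurable borel" "h \<in> borel_measurable borel" for g h :: "real \<times> real \<Rightarrow> real"
    using measurable_compose[OF borel_measurable_Pair[OF that] F] by simp
  let ?u = "\<lambda>k p. indicator A p * ((F (fst p) (snd p + 1 / real (Suc k)) - F (fst p) (snd p)) / (1 / real (Suc k)))"
  show "(\<lambda>k. ?u k p) \<longlonglongrightarrow> (case p of (a, t) \<Rightarrow> indicator A (a, t) * deriv (F a) t)" for p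
  proof (cases p)
    case (Pair a t)
    show ?thesis
    proof (cases "(a, t) \<in> A")
      case True
      have "((\<lambda>h. (F a (t + h) - F a t) / h) \<longlongrightarrow> deriv (F a) t) (at 0)"
        using diff[OF True] by (simp add: real_differentiable_def DERIV_deriv_iff_real_differentiable flip: DERIV_def)
      moreover have "filterlim (\<lambda>k. 1 / real (Suc k)) (at 0) sequentially"
        using LIMSEQ_inverse_real_of_nat by (auto simp: filterlim_at divide_inverse)
      ultimately have "(\<lambda>k. (F a (t + 1 / real (Suc k)) - F a t) / (1 / real (Suc k))) \<longlonglongrightarrow> deriv (F a) t"
        by (rule filterlim_compose)
      then show ?thesis using True Pair by simp
    qed (simp add: Pair)
  qed
  show "?u k \<in> borel_measurable borel" for k
    by measurable
qed

text \<open>Differentiability on \<open>S\<close> makes \<open>G\<close> continuous there, so cutting \<open>G\<close> off outside \<open>S\<close> gives a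
  measurable function; the cut does not change derivatives because \<open>S\<close> is open.\<close>

lemma borel_measurable_deriv_on:
  fixes G :: "real \<Rightarrow> real"
  assumes S: "open S" and diff: "\<And>t. t \<in> S \<Longrightarrow> G differentiable (at t)"
  shows "(\<lambda>t. indicator S t * deriv G t) \<in> borel_measurable borel"
proof -
  have cont: "continuous_on S G"
    using diff by (meson continuous_at_imp_continuous_on differentiable_imp_continuous_within)
  define H where "H = (\<lambda>t. indicator S t *\<^sub>R G t)"
  have H[measurable]: "H \<in> borel_measurable borel"
    unfolding H_def using S cont by (intro borel_measurable_continuous_on_indicator) auto
  have HG: "eventually (\<lambda>u. H u = G u) (nhds t)" if "t \<in> S" for t
    using eventually_nhds_in_open[OF S that] by eventually_elim (simp add: H_def)
  have "(\<lambda>(a::real, t). indicator (UNIV \<times> S) (a, t) * deriv H t) \<in> borel_measurable borel"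
  proof (rule borel_measurable_deriv_param)
    show "UNIV \<times> S \<in> sets borel" using S by (simp add: open_Times)
    show "(\<lambda>(a::real, t). H t) \<in> borel_measurable borel" 
      by (simp add: case_prod_beta borel_prod[symmetric])
    fix a :: real and t assume "(a, t) \<in> UNIV \<times> S"
    then have t: "t \<in> S" by simp
    show "H differentiable (at t)"
      using diff[OF t] DERIV_cong_ev[OF refl HG[OF t] refl] by (auto simp: real_differentiable_def)
  qed
  moreover have "(\<lambda>t. (0::real, t::real)) \<in> borel_measurable borel"
    by (auto intro!: borel_measurable_continuous_onI continuous_intros)
  ultimately have "(\<lambda>t. case (0::real, t) of (a, t) \<Rightarrow> indicator (UNIV \<times> S) (a, t) * deriv H t) \<in> borel_measurable borel"
    by (rule measurable_compose[rotated])
  then have "(\<lambda>t. indicator S t * deriv H t) \<in> borel_measurable borel"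
    by (simp add: indicator_times)
  moreover have "indicator S t * deriv H t = indicator S t * deriv G t" for t
    using deriv_cong_ev[OF HG refl] by (simp add: indicator_def)
  ultimately show ?thesis by simp
qed

text \<open>A derivative of constant sign satisfies the fundamental theorem of calculus without being
  continuous, which is what makes mere differentiability of the conditional distribution functions
  sufficient below.\<close>

lemma nn_integral_abs_deriv_Icc:
  fixes G :: "real \<Rightarrow> real"
  assumes S: "open S" and mono: "mono_on S G \<or> antimono_on S G"
    and diff: "\<And>t. t \<in> S \<Longrightarrow> G differentiable (at t)"
    and ab: "a \<le> b" "{a..b} \<subseteq> S"
  shows "(\<integral>\<^sup>+t. ennreal \<bar>deriv G t\<bar> * indicator {a..b} t \<partial>lborel) = ennreal \<bar>G b - G a\<bar>"
  using mono
proof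
  have *: "(\<integral>\<^sup>+t. ennreal \<bar>deriv H t\<bar> * indicator {a..b} t \<partial>lborel) = ennreal \<bar>H b - H a\<bar>"
    if m: "mono_on S H" and d: "\<And>t. t \<in> S \<Longrightarrow> H differentiable (at t)" for H :: "real \<Rightarrow> real"
  proof -
    have D: "(H has_real_derivative deriv H t) (at t)" if "t \<in> S" for t
      using d[OF that] by (simp add: DERIV_deriv_iff_real_differentiable)
    have nn: "0 \<le> deriv H t" if "t \<in> S" for t
      using mono_on_imp_deriv_nonneg[OF m D[OF that]] that S by (simp add: interior_open)
    have "(\<integral>\<^sup>+t. ennreal \<bar>deriv H t\<bar> * indicator {a..b} t \<partial>lborel)
        = (\<integral>\<^sup>+t. ennreal (indicator S t * deriv H t) * indicator {a..b} t \<partial>lborel)"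
      using ab nn by (intro nn_integral_cong) (auto simp: indicator_def)
    also have "\<dots> = ennreal (H b - H a)"
      by (rule nn_integral_FTC_Icc[OF borel_measurable_deriv_on[OF S d]])
         (use ab D nn in \<open>auto simp: indicator_def subset_iff\<close>)
    also have "H a \<le> H b" using m ab by (intro mono_onD[OF m]) auto
    then have "ennreal (H b - H a) = ennreal \<bar>H b - H a\<bar>" by simp
    finally show ?thesis .
  qed
  show ?thesis if "mono_on S G" using *[OF that diff] .
  assume anti: "antimono_on S G"
  have "deriv (\<lambda>t. - G t) t = - deriv G t" if "t \<in> S" for t
    using diff[OF that] by (intro DERIV_imp_deriv DERIV_minus) (simp add: DERIV_deriv_iff_real_differentiable)
  then have "(\<integral>\<^sup>+t. ennreal \<bar>deriv G t\<bar> * indicator {a..b} t \<partial>lborel)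
      = (\<integral>\<^sup>+t. ennreal \<bar>deriv (\<lambda>t. - G t) t\<bar> * indicator {a..b} t \<partial>lborel)"
    using ab by (intro nn_integral_cong) (auto simp: indicator_def)
  also have "\<dots> = ennreal \<bar>- G b - - G a\<bar>"
    by (rule *) (use anti diff in \<open>auto simp: monotone_on_def\<close>)
  also have "\<bar>- G b - - G a\<bar> = \<bar>G b - G a\<bar>" by simp
  finally show ?thesis .
qed

text \<open>Exhausting \<open>S\<close> by the compact intervals \<open>{a k..b k}\<close> turns the increments of \<open>G\<close> into its total
  variation, the distance between the two limits. This is why a fiducial density obtained from a
  distribution function with limits 0 and 1 is a probability density in the parameter.\<close>

lemma nn_integral_abs_deriv_eq_1:
  fixes G :: "real \<Rightarrow> real" and a b :: "nat \<Rightarrow> real"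
  assumes G: "monotone_differentiable_on S G" and lim: "limits_zero_one A B G"
    and S: "open S" "S = (\<Union>k. {a k..b k})"
    and ab: "decseq a" "incseq b" "\<And>k. a k \<le> b k"
    and A: "filterlim a A sequentially" and B: "filterlim b B sequentially"
  shows "(\<integral>\<^sup>+t. ennreal \<bar>deriv G t\<bar> * indicator S t \<partial>lborel) = 1"
proof -
  have mono: "mono_on S G \<or> antimono_on S G" and diff: "\<And>t. t \<in> S \<Longrightarrow> G differentiable (at t)"
    using G by (auto simp: monotone_differentiable_on_def)
  let ?D = "\<lambda>t. ennreal \<bar>indicator S t * deriv G t\<bar>"
  have D_meas: "?D \<in> borel_measurable lborel"
    using borel_measurable_deriv_on[OF S(1) diff] by measurable
  have D: "emeasure (density lborel ?D) X = (\<integral>\<^sup>+t. ennreal \<bar>deriv G t\<bar> * indicator X t \<partial>lborel)"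
    if [measurable]: "X \<in> sets borel" and "X \<subseteq> S" for X
  proof -
    have "emeasure (density lborel ?D) X = (\<integral>\<^sup>+t. ?D t * indicator X t \<partial>lborel)"
      by (rule emeasure_density[OF D_meas]) simp
    also have "\<dots> = (\<integral>\<^sup>+t. ennreal \<bar>deriv G t\<bar> * indicator X t \<partial>lborel)"
      using \<open>X \<subseteq> S\<close> by (intro nn_integral_cong) (auto simp: indicator_def)
    finally show ?thesis .
  qed
  have inc: "incseq (\<lambda>k. {a k..b k})"
    using ab unfolding incseq_def decseq_def by (fastforce intro: order_trans)
  have sub: "{a k..b k} \<subseteq> S" for k using S by auto
  have "(\<lambda>k. emeasure (density lborel ?D) {a k..b k}) \<longlonglongrightarrow> emeasure (density lborel ?D) (\<Union>k. {a k..b k})"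
    by (rule Lim_emeasure_incseq) (use inc in auto)
  also have "(\<lambda>k. emeasure (density lborel ?D) {a k..b k}) = (\<lambda>k. ennreal \<bar>G (b k) - G (a k)\<bar>)"
    using nn_integral_abs_deriv_Icc[OF S(1) mono diff ab(3) sub] D[OF _ sub] by simp
  also have "emeasure (density lborel ?D) (\<Union>k. {a k..b k}) = (\<integral>\<^sup>+t. ennreal \<bar>deriv G t\<bar> * indicator S t \<partial>lborel)"
    unfolding S(2)[symmetric] using S(1) by (intro D) auto
  finally have *: "(\<lambda>k. ennreal \<bar>G (b k) - G (a k)\<bar>) \<longlonglongrightarrow> (\<integral>\<^sup>+t. ennreal \<bar>deriv G t\<bar> * indicator S t \<partial>lborel)" .
  have "(\<lambda>k. \<bar>G (b k) - G (a k)\<bar>) \<longlonglongrightarrow> 1"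
  proof -
    obtain p q where p: "(G \<longlongrightarrow> p) A" and q: "(G \<longlongrightarrow> q) B" and pq: "\<bar>q - p\<bar> = 1"
      using lim that[of 0 1] that[of 1 0] unfolding limits_zero_one_def by auto
    have "(\<lambda>k. \<bar>G (b k) - G (a k)\<bar>) \<longlonglongrightarrow> \<bar>q - p\<bar>"
      by (intro tendsto_rabs tendsto_diff filterlim_compose[OF q B] filterlim_compose[OF p A])
    then show ?thesis unfolding pq .
  qed
  then have "(\<lambda>k. ennreal \<bar>G (b k) - G (a k)\<bar>) \<longlonglongrightarrow> 1"
    using tendsto_ennrealI by fastforce
  then show ?thesis using * LIMSEQ_unique by blast
qed

text \<open>The exceptional set for \<open>Q (\<phi> x)\<close> is contained in the image of a null set under the
  differentiable left inverse \<open>\<psi>\<close>. It serves to pass between a parameter and the value of a pivot.\<close>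

lemma AE_lborel_transport:
  fixes \<phi> \<psi> :: "real \<Rightarrow> real"
  assumes Q: "AE y in lborel. Q y"
    and inv: "\<And>x. x \<in> S \<Longrightarrow> \<psi> (\<phi> x) = x" and diff: "\<psi> differentiable_on \<phi> ` S"
  shows "AE x in lborel. x \<in> S \<longrightarrow> Q (\<phi> x)"
proof -
  obtain N where N: "negligible N" "{y. \<not> Q y} \<subseteq> N"
    using Q unfolding AE_completion_iff[of _ lborel, symmetric] eventually_ae_filter_negligible by blast
  have "negligible (\<psi> ` (N \<inter> \<phi> ` S))"
    by (rule negligible_differentiable_image_negligible)
       (use N diff in \<open>auto intro: negligible_subset differentiable_on_subset\<close>)
  moreover have "{x. \<not> (x \<in> S \<longrightarrow> Q (\<phi> x))} \<subseteq> \<psi> ` (N \<inter> \<phi> ` S)"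
  proof
    fix x assume "x \<in> {x. \<not> (x \<in> S \<longrightarrow> Q (\<phi> x))}"
    then have "x \<in> S" "\<not> Q (\<phi> x)" by auto
    then show "x \<in> \<psi> ` (N \<inter> \<phi> ` S)" using inv[of x] N by (intro image_eqI[of _ _ "\<phi> x"]) auto
  qed
  ultimately show ?thesis
    unfolding AE_completion_iff[of _ lborel, symmetric] eventually_ae_filter_negligible by blast
qed

text \<open>A special case of Lebesgue's differentiation theorem that has an elementary proof: where \<open>P\<close> is
  differentiable throughout an interval, \<open>deriv P\<close> and \<open>p\<close> have the same integral, an increment of
  \<open>P\<close>, over all its subintervals, so the measures with these densities agree and hence so do the
  densities almost everywhere. Countably many intervals with rational end points cover \<open>S\<close>.\<close>

lemma AE_deriv_indefinite_integral:
  fixes p :: "real \<Rightarrow> real"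
  defines "P \<equiv> \<lambda>y. LINT t:{..y}|lborel. p t"
  assumes p: "integrable lborel p" and nn: "\<And>t. 0 \<le> p t"
    and S: "open S" and diff: "\<And>y. y \<in> S \<Longrightarrow> P differentiable (at y)"
  shows "AE y in lborel. y \<in> S \<longrightarrow> deriv P y = p y"
proof -
  have [measurable]: "p \<in> borel_measurable borel" using p by auto
  have si: "set_integrable lborel B p" if "B \<in> sets borel" for B
    unfolding set_integrable_def by (rule integrable_mult_indicator) (use p that in simp_all)
  have incr: "(\<integral>\<^sup>+t. ennreal (p t) * indicator {a..b} t \<partial>lborel) = ennreal (P b - P a)" and incr0: "P a \<le> P b"
    if "a \<le> b" for a b
  proof -
    have "P b = P a + (LINT t:{a<..b}|lborel. p t)"
      unfolding P_def using that
      by (subst set_integral_Un[symmetric]) (auto intro!: si simp: ivl_disj_un)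
    then have *: "P b - P a = (LINT t:{a<..b}|lborel. p t)" by simp
    also have "ennreal \<dots> = (\<integral>\<^sup>+t. ennreal (indicator {a<..b} t *\<^sub>R p t) \<partial>lborel)"
      unfolding set_lebesgue_integral_def
      by (rule nn_integral_eq_integral[symmetric]) (use si[of "{a<..b}"] nn in \<open>auto simp: set_integrable_def\<close>)
    also have "\<dots> = (\<integral>\<^sup>+t. ennreal (p t) * indicator {a..b} t \<partial>lborel)"
    proof (rule nn_integral_cong_AE, use AE_lborel_singleton[of a] in eventually_elim)
      show "ennreal (indicator {a<..b} t *\<^sub>R p t) = ennreal (p t) * indicator {a..b} t" if "t \<noteq> a" for t
        using that by (auto simp: indicator_def)
    qed
    finally show "(\<integral>\<^sup>+t. ennreal (p t) * indicator {a..b} t \<partial>lborel) = ennreal (P b - P a)" by simp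
    have "0 \<le> (LINT t:{a<..b}|lborel. p t)"
      unfolding set_lebesgue_integral_def using nn by (intro integral_nonneg_AE) auto
    then show "P a \<le> P b" using * by simp
  qed
  have mono: "mono_on S P \<or> antimono_on S P" using incr0 by (auto simp: mono_on_def)
  let ?D = "\<lambda>t. indicator S t * deriv P t"
  have [measurable]: "?D \<in> borel_measurable borel"
    by (rule borel_measurable_deriv_on[OF S diff])
  have D0: "0 \<le> deriv P t" if "t \<in> S" for t
  proof (rule mono_on_imp_deriv_nonneg)
    show "mono_on UNIV P" using incr0 by (auto simp: mono_on_def)
    show "(P has_real_derivative deriv P t) (at t)"
      using diff[OF that] by (simp add: DERIV_deriv_iff_real_differentiable)
  qed simp
  have loc: "AE y in lborel. y \<in> {a..b} \<longrightarrow> deriv P y = p y" if ab: "{a..b} \<subseteq> S" for a b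
  proof -
    let ?f = "\<lambda>t. ennreal (?D t) * indicator {a..b} t" and ?g = "\<lambda>t. ennreal (p t) * indicator {a..b} t"
    \<comment> \<open>Open half-lines determine a finite measure; the single points in which they differ from closed
      intervals are null.\<close>
    have half: "emeasure (density lborel h) {x<..} = (\<integral>\<^sup>+t. h0 t * indicator {max a x..b} t \<partial>lborel)"
      if h: "h = (\<lambda>t. h0 t * indicator {a..b} t)" and [measurable]: "h0 \<in> borel_measurable borel" for h h0 x
    proof -
      have "emeasure (density lborel h) {x<..} = (\<integral>\<^sup>+t. h t * indicator {x<..} t \<partial>lborel)"
        unfolding h by (rule emeasure_density) measurable
      also have "\<dots> = (\<integral>\<^sup>+t. h0 t * indicator {max a x..b} t \<partial>lborel)"
      proof (rule nn_integral_cong_AE, use AE_lborel_singleton[of x] in eventually_elim)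
        show "h t * indicator {x<..} t = h0 t * indicator {max a x..b} t" if "t \<noteq> x" for t
          using that by (auto simp: indicator_def h)
      qed
      finally show ?thesis .
    qed
    have f: "emeasure (density lborel ?f) {x<..} = (if max a x \<le> b then ennreal (P b - P (max a x)) else 0)" for x
    proof (cases "max a x \<le> b")
      case True
      have "emeasure (density lborel ?f) {x<..} = (\<integral>\<^sup>+t. ennreal (?D t) * indicator {max a x..b} t \<partial>lborel)"
        by (rule half) auto
      also have "\<dots> = (\<integral>\<^sup>+t. ennreal \<bar>deriv P t\<bar> * indicator {max a x..b} t \<partial>lborel)"
        using ab D0 by (intro nn_integral_cong) (auto simp: indicator_def subset_iff)
      also have "\<dots> = ennreal \<bar>P b - P (max a x)\<bar>"
        by (rule nn_integral_abs_deriv_Icc[OF S mono diff True]) (use ab in auto)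
      finally show ?thesis using True incr0[OF True] by simp
    next
      case False
      have "emeasure (density lborel ?f) {x<..} = (\<integral>\<^sup>+t. ennreal (?D t) * indicator {max a x..b} t \<partial>lborel)"
        by (rule half) auto
      then show ?thesis using False by auto
    qed
    have g: "emeasure (density lborel ?g) {x<..} = (if max a x \<le> b then ennreal (P b - P (max a x)) else 0)" for x
    proof -
      have "emeasure (density lborel ?g) {x<..} = (\<integral>\<^sup>+t. ennreal (p t) * indicator {max a x..b} t \<partial>lborel)"
        by (rule half) auto
      then show ?thesis using incr[of "max a x" b] by (cases "max a x \<le> b") simp_all
    qed
    have "density lborel ?f = density lborel ?g"
    proof (rule measure_eqI_lessThan)
      show "emeasure (density lborel ?f) {x<..} < \<infinity>" for x
        unfolding f by simp
      show "emeasure (density lborel ?f) {x<..} = emeasure (density lborel ?g) {x<..}" for x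
        unfolding f g ..
    qed simp_all
    then have "AE t in lborel. ?f t = ?g t"
      by (rule sigma_finite_measure.density_unique_iff[OF lborel.sigma_finite_measure_axioms, THEN iffD1, rotated 2]) measurable
    then show ?thesis
    proof eventually_elim
      case (elim t)
      show ?case
      proof
        assume t: "t \<in> {a..b}"
        then have "t \<in> S" using ab by auto
        then show "deriv P t = p t" using elim t D0 nn by simp
      qed
    qed
  qed
  have "AE y in lborel. \<forall>q\<in>{(a, b). a \<in> \<rat> \<and> b \<in> \<rat> \<and> {a..b} \<subseteq> S}. y \<in> {fst q..snd q} \<longrightarrow> deriv P y = p y"
  proof (rule AE_ball_countable')
    show "countable {(a::real, b::real). a \<in> \<rat> \<and> b \<in> \<rat> \<and> {a..b} \<subseteq> S}"
      by (rule countable_subset[of _ "\<rat> \<times> \<rat>"]) (auto intro!: countable_SIGMA countable_rat)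
  qed (use loc in auto)
  then show ?thesis
  proof eventually_elim
    case (elim y)
    show ?case
    proof
      assume "y \<in> S"
      then obtain e where e: "0 < e" "cball y e \<subseteq> S" using S open_contains_cball by blast
      obtain a where a: "a \<in> \<rat>" "y - e < a" "a < y" using Rats_dense_in_real[of "y - e" y] e by auto
      obtain b where b: "b \<in> \<rat>" "y < b" "b < y + e" using Rats_dense_in_real[of y "y + e"] e by auto
      have "{a..b} \<subseteq> cball y e" using a b by (auto simp: dist_real_def)
      then have "{a..b} \<subseteq> S" using e(2) by (rule order_trans)
      then show "deriv P y = p y"
        using bspec[OF elim, of "(a, b)"] a b by simp
    qed
  qed
qed

section \<open>Equivariance and pivots\<close>

text \<open>The location-scale map sends \<open>(X\<^sub>1, Z\<^sub>2)\<close> to \<open>(\<theta> + \<sigma> X\<^sub>1, \<sigma> Z\<^sub>2)\<close> and fixes the ratios \<open>Z\<close>; its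
  Jacobian is \<open>\<sigma>\<^sup>2\<close>, whatever \<open>n\<close> is.\<close>

lemma joint_density_equivariant:
  assumes \<sigma>: "0 < \<sigma>" and n: "2 \<le> n"
  shows "joint_density f n \<theta> \<sigma> t w z = joint_density f n 0 1 ((t - \<theta>) / \<sigma>) (w / \<sigma>) z / \<sigma>\<^sup>2"
proof -
  have "likelihood f n \<theta> \<sigma> (sample_of n t w z) =
      (\<Prod>i\<in>{1..n}. (1 / \<sigma>) * ls_density f 0 1 (sample_of n ((t - \<theta>) / \<sigma>) (w / \<sigma>) z i))"
    unfolding likelihood_def
    using \<sigma> by (intro prod.cong) (auto simp: sample_of_def ls_density_def add_divide_distrib diff_divide_distrib algebra_simps)
  also have "\<dots> = (1 / \<sigma>) ^ n * likelihood f n 0 1 (sample_of n ((t - \<theta>) / \<sigma>) (w / \<sigma>) z)"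
    by (simp only: prod.distrib likelihood_def prod_constant) simp
  finally have *: "likelihood f n \<theta> \<sigma> (sample_of n t w z) = \<dots>" .
  have "\<sigma> ^ n = \<sigma> ^ (n - 2) * \<sigma>\<^sup>2"
    using n by (metis le_add_diff_inverse2 power_add)
  then show ?thesis
    using \<sigma> by (simp add: joint_density_def * power_divide power_one_over field_simps)
qed

lemma dens_Z2_Z_equivariant:
  assumes \<sigma>: "0 < \<sigma>" and n: "2 \<le> n"
  shows "dens_Z2_Z f n \<theta> \<sigma> w z = dens_Z2_Z f n 0 1 (w / \<sigma>) z / \<sigma>"
  unfolding dens_Z2_Z_def joint_density_equivariant[OF \<sigma> n, of f \<theta> _ w z]
  using \<sigma> by (subst lborel_integral_real_affine[of \<sigma> _ \<theta>]) (simp_all add: power2_eq_square)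

lemma set_integral_atMost_affine:
  fixes h :: "real \<Rightarrow> real"
  assumes "0 < \<sigma>"
  shows "(LINT t:{..b}|lborel. h ((t - a) / \<sigma>)) = \<sigma> * (LINT u:{..(b - a) / \<sigma>}|lborel. h u)"
proof -
  have "indicator {..b} (a + \<sigma> * u) = (indicator {..(b - a) / \<sigma>} u :: real)" for u
    using assms by (auto simp: indicator_def field_simps)
  then show ?thesis
    unfolding set_lebesgue_integral_def
    using assms by (subst lborel_integral_real_affine[of \<sigma> _ a]) simp_all
qed

text \<open>Given \<open>Z\<close>, the ratio \<open>Z\<^sub>2 / \<sigma>\<close> is a pivot: the distribution function depends on \<open>\<sigma>\<close> only through
  the upper limit of an integral of a parameter-free density. This turns a derivative in the
  parameter into a derivative of an indefinite integral.\<close>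

lemma cond_cdf_Z2_pivot:
  assumes \<sigma>: "0 < \<sigma>" and n: "2 \<le> n"
  shows "cond_cdf_Z2 f n \<theta> \<sigma> w z
    = (LINT v:{..w / \<sigma>}|lborel. dens_Z2_Z f n 0 1 v z) / dens_Z f n 0 1 z"
proof -
  have "cond_cdf_Z2 f n \<theta> \<sigma> w z
      = (LINT t:{..w}|lborel. dens_Z2_Z f n 0 1 ((t - 0) / \<sigma>) z / (\<sigma> * dens_Z f n 0 1 z))"
    unfolding cond_cdf_Z2_def cond_dens_Z2_def dens_Z_ancillary[OF \<sigma> n, of f \<theta>]
    by (simp add: dens_Z2_Z_equivariant[OF \<sigma> n, of f \<theta>])
  also have "\<dots> = (LINT t:{..w}|lborel. dens_Z2_Z f n 0 1 ((t - 0) / \<sigma>) z) / (\<sigma> * dens_Z f n 0 1 z)"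
    by (rule set_integral_divide_zero)
  also have "\<dots> = (LINT v:{..w / \<sigma>}|lborel. dens_Z2_Z f n 0 1 v z) / dens_Z f n 0 1 z"
    using set_integral_atMost_affine[OF \<sigma>, of w "\<lambda>v. dens_Z2_Z f n 0 1 v z" 0] \<sigma> by simp
  finally show ?thesis .
qed

text \<open>The same for the pivot \<open>(X\<^sub>1 - \<theta>) / \<sigma>\<close> given \<open>(Z\<^sub>2, Z)\<close>. If the denominator vanishes both
  sides are 0.\<close>

lemma cond_cdf_X1_pivot:
  assumes \<sigma>: "0 < \<sigma>" and n: "2 \<le> n"
  shows "cond_cdf_X1 f n \<theta> \<sigma> t w z
    = (LINT u:{..(t - \<theta>) / \<sigma>}|lborel. joint_density f n 0 1 u (w / \<sigma>) z) / dens_Z2_Z f n 0 1 (w / \<sigma>) z"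
proof -
  let ?m = "dens_Z2_Z f n 0 1 (w / \<sigma>) z"
  have "cond_cdf_X1 f n \<theta> \<sigma> t w z
      = (LINT s:{..t}|lborel. joint_density f n 0 1 ((s - \<theta>) / \<sigma>) (w / \<sigma>) z / (\<sigma> * ?m))"
    unfolding cond_cdf_X1_def cond_dens_X1_def dens_Z2_Z_equivariant[OF \<sigma> n, of f \<theta> w]
      joint_density_equivariant[OF \<sigma> n, of f \<theta> _ w]
    using \<sigma> by (simp add: power2_eq_square)
  also have "\<dots> = (LINT s:{..t}|lborel. joint_density f n 0 1 ((s - \<theta>) / \<sigma>) (w / \<sigma>) z) / (\<sigma> * ?m)"
    by (rule set_integral_divide_zero)
  also have "\<dots> = (LINT u:{..(t - \<theta>) / \<sigma>}|lborel. joint_density f n 0 1 u (w / \<sigma>) z) / ?m"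
    using set_integral_atMost_affine[OF \<sigma>, of t "\<lambda>u. joint_density f n 0 1 u (w / \<sigma>) z" \<theta>] \<sigma> by simp
  finally show ?thesis .
qed

lemma F_sigma_location_free: "F_sigma f n x \<theta> = F_sigma f n x 0"
  by (rule ext) (simp add: F_sigma_def cond_cdf_Z2_def cond_dens_Z2_def dens_Z_def
      dens_Z2_Z_location_free[of f n \<theta>])

lemma joint_density_at_sample:
  assumes "2 \<le> n" "x 1 \<noteq> x 2"
  shows "joint_density f n \<theta> \<sigma> (x 1) (stat_Z2 x) (stat_Z n x)
    = \<bar>stat_Z2 x\<bar> ^ (n - 2) * likelihood f n \<theta> \<sigma> x"
proof -
  have "sample_of n (x 1) (stat_Z2 x) (stat_Z n x) i = x i" if "i \<in> {1..n}" for i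
    using assms that by (auto simp: sample_of_def stat_Z_def stat_Z2_def)
  then show ?thesis by (simp add: joint_density_def likelihood_def)
qed

lemma joint_density_nonneg:
  assumes "is_density f" "0 < \<sigma>"
  shows "0 \<le> joint_density f n \<theta> \<sigma> t w z"
  unfolding joint_density_def likelihood_def
  using ls_density_props(2)[OF assms] by (simp add: prod_nonneg)

section \<open>Measurability of the densities in the parameters\<close>

lemma borel_measurable_likelihood:
  assumes f[measurable]: "f \<in> borel_measurable borel"
    and [measurable]: "\<Theta> \<in> borel_measurable M" "\<Sigma> \<in> borel_measurable M"
    and [measurable]: "\<And>i. i \<in> {1..n} \<Longrightarrow> (\<lambda>p. X p i) \<in> borel_measurable M"
  shows "(\<lambda>p. likelihood f n (\<Theta> p) (\<Sigma> p) (X p)) \<in> borel_measurable M"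
  unfolding likelihood_def ls_density_def by measurable

lemma borel_measurable_joint_density:
  assumes [measurable]: "f \<in> borel_measurable borel"
    and [measurable]: "\<Theta> \<in> borel_measurable M" "\<Sigma> \<in> borel_measurable M" "T \<in> borel_measurable M" "W \<in> borel_measurable M"
  shows "(\<lambda>p. joint_density f n (\<Theta> p) (\<Sigma> p) (T p) (W p) z) \<in> borel_measurable M"
proof -
  have [measurable]: "(\<lambda>p. likelihood f n (\<Theta> p) (\<Sigma> p) (sample_of n (T p) (W p) z)) \<in> borel_measurable M"
  proof (rule borel_measurable_likelihood)
    show "(\<lambda>p. sample_of n (T p) (W p) z i) \<in> borel_measurable M" if "i \<in> {1..n}" for i
      using that unfolding sample_of_def by simp
  qed measurable
  show ?thesis unfolding joint_density_def by measurable
qed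

lemma borel_measurable_F_theta:
  assumes f: "is_density f"
  shows "(\<lambda>(\<sigma>, \<theta>). F_theta f n x \<sigma> \<theta>) \<in> borel_measurable borel"
proof -
  have [measurable]: "f \<in> borel_measurable borel" using f by (simp add: is_density_def)
  note [measurable] = borel_measurable_joint_density
  have [measurable]: "(\<lambda>p. dens_Z2_Z f n (snd p) (fst p) w z) \<in> borel_measurable (borel \<Otimes>\<^sub>M borel)" for w z
    unfolding dens_Z2_Z_def by measurable
  have "(\<lambda>p. F_theta f n x (fst p) (snd p)) \<in> borel_measurable (borel \<Otimes>\<^sub>M borel)"
    unfolding F_theta_def cond_cdf_X1_def cond_dens_X1_def set_lebesgue_integral_def by measurable
  then show ?thesis by (simp add: borel_prod case_prod_beta)
qed

section \<open>The two factors of the fiducial density\<close>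

text \<open>The second step: by the pivot form, differentiating in \<open>\<theta>\<close> recovers, up to sign, the
  conditional density of \<open>X\<^sub>1\<close>. The equation is stated after multiplication by the density of \<open>(Z\<^sub>2, Z)\<close> so that it also
  covers the values of \<open>\<sigma>\<close> at which that density is 0; there the joint density, being nonnegative
  and integrable with integral 0, vanishes almost everywhere. Integrability of the section is
  essential in that case, since a section that is not integrable has Bochner integral 0 as well.\<close>

lemma AE_abs_deriv_F_theta:
  assumes f: "is_density f" and n: "2 \<le> n" and \<sigma>: "0 < \<sigma>"
    and int: "integrable lborel (\<lambda>u. joint_density f n 0 1 u (stat_Z2 x / \<sigma>) (stat_Z n x))"
    and diff: "\<And>\<theta>. F_theta f n x \<sigma> differentiable (at \<theta>)"
  shows "AE \<theta> in lborel. dens_Z2_Z f n \<theta> \<sigma> (stat_Z2 x) (stat_Z n x) * \<bar>deriv (F_theta f n x \<sigma>) \<theta>\<bar>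
    = joint_density f n \<theta> \<sigma> (x 1) (stat_Z2 x) (stat_Z n x)"
proof -
  define g where "g u = joint_density f n 0 1 u (stat_Z2 x / \<sigma>) (stat_Z n x)" for u
  define P where "P u = (LINT s:{..u}|lborel. g s)" for u
  define m where "m = dens_Z2_Z f n 0 1 (stat_Z2 x / \<sigma>) (stat_Z n x)"
  have g0: "0 \<le> g u" for u by (simp add: g_def joint_density_nonneg[OF f])
  have g_int: "integrable lborel g" using int by (simp add: g_def[abs_def])
  have m: "m = (\<integral>u. g u \<partial>lborel)" by (simp add: m_def g_def dens_Z2_Z_def)
  have J: "joint_density f n \<theta> \<sigma> (x 1) (stat_Z2 x) (stat_Z n x) = g ((x 1 - \<theta>) / \<sigma>) / \<sigma>\<^sup>2" for \<theta>
    by (simp add: joint_density_equivariant[OF \<sigma> n, of f \<theta>] g_def)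
  have D: "dens_Z2_Z f n \<theta> \<sigma> (stat_Z2 x) (stat_Z n x) = m / \<sigma>" for \<theta>
    by (simp add: dens_Z2_Z_equivariant[OF \<sigma> n, of f \<theta>] m_def)
  have F: "F_theta f n x \<sigma> \<theta> = P ((x 1 - \<theta>) / \<sigma>) / m" for \<theta>
    by (simp add: F_theta_def cond_cdf_X1_pivot[OF \<sigma> n] P_def g_def m_def)
  have transport: "AE \<theta> in lborel. Q ((x 1 - \<theta>) / \<sigma>)" if "AE u in lborel. Q u" for Q
  proof -
    have "AE \<theta> in lborel. \<theta> \<in> UNIV \<longrightarrow> Q ((x 1 - \<theta>) / \<sigma>)"
      using that by (rule AE_lborel_transport[where \<psi> = "\<lambda>u. x 1 - \<sigma> * u"])
        (use \<sigma> in \<open>auto intro!: derivative_intros\<close>)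
    then show ?thesis by simp
  qed
  show ?thesis
  proof (cases "m = 0")
    case True
    then have "AE u in lborel. g u = 0"
      using g_int g0 m by (simp add: integral_nonneg_eq_0_iff_AE)
    from transport[OF this] show ?thesis
    proof eventually_elim
      case (elim \<theta>)
      then show ?case unfolding D J True by simp
    qed
  next
    case False
    \<comment> \<open>Solving the pivot form for \<open>P\<close> transfers differentiability from the distribution function
      to the indefinite integral; this step divides by \<open>m\<close>, whence the separate treatment of \<open>m = 0\<close>.\<close>
    have P: "P differentiable (at u)" for u
    proof -
      have "P = (\<lambda>u. m * F_theta f n x \<sigma> (x 1 - \<sigma> * u))"
        using False \<sigma> by (simp add: F fun_eq_iff)
      moreover have "(\<lambda>u. m * F_theta f n x \<sigma> (x 1 - \<sigma> * u)) differentiable (at u)"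
      proof -
        obtain d where "(F_theta f n x \<sigma> has_real_derivative d) (at (x 1 - \<sigma> * u))"
          using diff by (auto simp: real_differentiable_def)
        then have "((\<lambda>u. m * F_theta f n x \<sigma> (x 1 - \<sigma> * u)) has_real_derivative m * (d * - \<sigma>)) (at u)"
          by (intro DERIV_cmult DERIV_chain2[where f="F_theta f n x \<sigma>"]) (auto intro!: derivative_eq_intros)
        then show ?thesis by (auto simp: real_differentiable_def)
      qed
      ultimately show ?thesis by simp
    qed
    have "AE u in lborel. deriv P u = g u"
      using AE_deriv_indefinite_integral[OF g_int g0, of UNIV] P by (simp add: P_def[abs_def])
    from transport[OF this] show ?thesis
    proof eventually_elim
      case (elim \<theta>)
      have "(P has_real_derivative g ((x 1 - \<theta>) / \<sigma>)) (at ((x 1 - \<theta>) / \<sigma>))"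
        using P elim by (metis DERIV_deriv_iff_real_differentiable)
      then have "((\<lambda>\<theta>. P ((x 1 - \<theta>) / \<sigma>) / m) has_real_derivative (g ((x 1 - \<theta>) / \<sigma>) * (- 1 / \<sigma>)) / m) (at \<theta>)"
        using \<sigma> by (intro DERIV_cdivide DERIV_chain2[where f=P]) (auto intro!: derivative_eq_intros)
      then have "deriv (F_theta f n x \<sigma>) \<theta> = g ((x 1 - \<theta>) / \<sigma>) * (- 1 / \<sigma>) / m"
        unfolding F[abs_def] by (rule DERIV_imp_deriv)
      moreover have "0 < m" using False m g0 by (simp add: less_le integral_nonneg_AE)
      ultimately show ?case
        unfolding D J using \<sigma> g0 by (simp add: abs_mult power2_eq_square)
    qed
  qed
qed

text \<open>The first step: by the chain rule for \<open>\<sigma> \<mapsto> z2 / \<sigma>\<close>, the derivative in \<open>\<sigma>\<close> is, up to sign,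
  the conditional density of \<open>Z\<^sub>2\<close> times \<open>\<bar>z2\<bar> / \<sigma>\<close>. This factor is the source of the prior \<open>1 / \<sigma>\<close>.\<close>

lemma AE_abs_deriv_F_sigma:
  assumes f: "is_density f" and n: "2 \<le> n" and Z2: "stat_Z2 x \<noteq> 0"
    and int: "integrable lborel (\<lambda>v. dens_Z2_Z f n 0 1 v (stat_Z n x))"
    and c: "0 < dens_Z f n 0 1 (stat_Z n x)"
    and diff: "\<And>\<sigma>. 0 < \<sigma> \<Longrightarrow> F_sigma f n x \<theta> differentiable (at \<sigma>)"
  shows "AE \<sigma> in lborel. 0 < \<sigma> \<longrightarrow> \<bar>deriv (F_sigma f n x \<theta>) \<sigma>\<bar>
    = \<bar>stat_Z2 x\<bar> / (\<sigma> * dens_Z f n 0 1 (stat_Z n x)) * dens_Z2_Z f n \<theta> \<sigma> (stat_Z2 x) (stat_Z n x)"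
proof -
  define m where "m v = dens_Z2_Z f n 0 1 v (stat_Z n x)" for v
  define c where "c = dens_Z f n 0 1 (stat_Z n x)"
  define M where "M y = (LINT v:{..y}|lborel. m v)" for y
  let ?w = "stat_Z2 x"
  \<comment> \<open>The pivot \<open>z2 / \<sigma>\<close> runs through the half-line of numbers with the sign of \<open>z2\<close>.\<close>
  let ?S = "{y. 0 < ?w * y}"
  have c0: "0 < c" using c by (simp add: c_def)
  have m0: "0 \<le> m v" for v
    unfolding m_def dens_Z2_Z_def by (intro integral_nonneg_AE) (simp add: joint_density_nonneg[OF f])
  have F: "F_sigma f n x \<theta> \<sigma> = M (?w / \<sigma>) / c" if "0 < \<sigma>" for \<sigma>
    by (simp add: F_sigma_def cond_cdf_Z2_pivot[OF that n] M_def m_def c_def)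
  have S: "open ?S"
    by (rule open_Collect_less) (auto intro!: continuous_intros)
  have in_S: "?w / \<sigma> \<in> ?S" if "0 < \<sigma>" for \<sigma>
    using that Z2 by (auto simp: zero_less_mult_iff zero_less_divide_iff divide_less_0_iff linorder_neq_iff)
  have pos: "0 < ?w / y" if "y \<in> ?S" for y
    using that by (simp add: zero_less_mult_iff zero_less_divide_iff)
  have M: "M differentiable (at y)" if y: "y \<in> ?S" for y
  proof -
    obtain d where d: "(F_sigma f n x \<theta> has_real_derivative d) (at (?w / y))"
      using diff[OF pos[OF y]] by (auto simp: real_differentiable_def)
    have "y \<noteq> 0" using y by auto
    then have "((\<lambda>y. ?w / y) has_real_derivative - ?w / y\<^sup>2) (at y)"
      by (auto intro!: derivative_eq_intros simp: power2_eq_square)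
    then have "((\<lambda>y. c * F_sigma f n x \<theta> (?w / y)) has_real_derivative c * (d * (- ?w / y\<^sup>2))) (at y)"
      using d by (intro DERIV_cmult DERIV_chain2[where f="F_sigma f n x \<theta>"])
    then have "(M has_real_derivative c * (d * (- ?w / y\<^sup>2))) (at y)"
    proof (rule has_field_derivative_transform_within_open[OF _ S y])
      fix y assume "y \<in> ?S"
      then show "c * F_sigma f n x \<theta> (?w / y) = M y"
        using F[OF pos] c0 Z2 by simp
    qed
    then show ?thesis by (auto simp: real_differentiable_def)
  qed
  have m_int: "integrable lborel m" using int by (simp add: m_def[abs_def])
  have "AE y in lborel. y \<in> ?S \<longrightarrow> deriv M y = m y"
    using AE_deriv_indefinite_integral[OF m_int m0 S] M by (simp add: M_def[abs_def])
  then have "AE \<sigma> in lborel. \<sigma> \<in> {0<..} \<longrightarrow> ?w / \<sigma> \<in> ?S \<longrightarrow> deriv M (?w / \<sigma>) = m (?w / \<sigma>)"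
  proof (rule AE_lborel_transport[where \<psi> = "\<lambda>y. ?w / y"])
    show "(\<lambda>y. ?w / y) differentiable_on (\<lambda>\<sigma>. ?w / \<sigma>) ` {0<..}"
      using Z2 by (auto intro!: derivative_intros simp: differentiable_on_def)
  qed (use Z2 in simp)
  then show ?thesis
  proof eventually_elim
    case (elim \<sigma>)
    show ?case
    proof
      assume \<sigma>: "0 < \<sigma>"
      then have "(M has_real_derivative m (?w / \<sigma>)) (at (?w / \<sigma>))"
        using elim M[OF in_S] in_S by (metis DERIV_deriv_iff_real_differentiable greaterThan_iff)
      moreover have "((\<lambda>\<sigma>. ?w / \<sigma>) has_real_derivative - ?w / \<sigma>\<^sup>2) (at \<sigma>)"
        using \<sigma> by (auto intro!: derivative_eq_intros simp: power2_eq_square)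
      ultimately have "((\<lambda>\<sigma>. M (?w / \<sigma>) / c) has_real_derivative m (?w / \<sigma>) * (- ?w / \<sigma>\<^sup>2) / c) (at \<sigma>)"
        by (intro DERIV_cdivide DERIV_chain2[where f=M])
      then have "(F_sigma f n x \<theta> has_real_derivative m (?w / \<sigma>) * (- ?w / \<sigma>\<^sup>2) / c) (at \<sigma>)"
        by (rule has_field_derivative_transform_within_open[of _ _ _ "{0<..}"]) (use \<sigma> F in auto)
      then have "\<bar>deriv (F_sigma f n x \<theta>) \<sigma>\<bar> = m (?w / \<sigma>) * \<bar>?w\<bar> / \<sigma>\<^sup>2 / c"
        using m0 c0 by (simp add: DERIV_imp_deriv abs_mult)
      then show "\<bar>deriv (F_sigma f n x \<theta>) \<sigma>\<bar>
          = \<bar>?w\<bar> / (\<sigma> * dens_Z f n 0 1 (stat_Z n x)) * dens_Z2_Z f n \<theta> \<sigma> ?w (stat_Z n x)"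
        by (simp add: dens_Z2_Z_equivariant[OF \<sigma> n, of f \<theta>] m_def c_def power2_eq_square mult_ac)
    qed
  qed
qed

section \<open>Measures on the parameter space\<close>

text \<open>This holds for every \<open>M\<close>, including measures of total mass 0 or \<open>\<infinity>\<close>, because
  multiplication by a positive real number preserves both extremes.\<close>

lemma normalize_scale_measure:
  assumes "0 < K"
  shows "normalize_measure (scale_measure (ennreal K) M) = normalize_measure M"
proof -
  have "inverse (ennreal K * e) * ennreal K = inverse e" for e
  proof (cases e rule: ennreal_cases)
    case (real r)
    then show ?thesis
      using assms by (cases "r = 0") (auto simp: ennreal_mult[symmetric] inverse_ennreal ennreal_top_mult)
  next
    case top
    then show ?thesis using assms by (simp add: ennreal_mult_top)
  qed
  then show ?thesis by (simp add: normalize_measure_def space_scale_measure)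
qed

lemma normalize_measure_prob:
  "emeasure M (space M) = 1 \<Longrightarrow> normalize_measure M = M"
  by (simp add: normalize_measure_def)

text \<open>The derivative in \<open>\<sigma>\<close> may be taken at \<open>\<theta> = 0\<close>, so the first factor depends on \<open>\<sigma>\<close> alone.\<close>

lemma fiducial_density_eq:
  "fiducial_density f n x \<sigma> \<theta> = \<bar>deriv (F_sigma f n x 0) \<sigma>\<bar> * \<bar>deriv (F_theta f n x \<sigma>) \<theta>\<bar>"
  by (simp add: fiducial_density_def F_sigma_location_free[of f n x \<theta>])

lemma borel_measurable_fiducial_density:
  assumes f: "is_density f"
    and diff_sigma: "\<And>\<sigma>. 0 < \<sigma> \<Longrightarrow> F_sigma f n x 0 differentiable (at \<sigma>)"
    and diff_theta: "\<And>\<sigma> \<theta>. 0 < \<sigma> \<Longrightarrow> F_theta f n x \<sigma> differentiable (at \<theta>)"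
  shows "(\<lambda>(\<sigma>, \<theta>). indicator {0<..} \<sigma> * fiducial_density f n x \<sigma> \<theta>) \<in> borel_measurable borel"
proof -
  have [measurable]: "{0::real<..} \<times> (UNIV :: real set) \<in> sets borel"
    by (simp add: open_Times)
  have 1: "(\<lambda>(\<sigma>, \<theta>). indicator ({0<..} \<times> UNIV) (\<sigma>, \<theta>) * deriv (F_theta f n x \<sigma>) \<theta>) \<in> borel_measurable borel"
    by (rule borel_measurable_deriv_param[OF borel_measurable_F_theta[OF f]]) (use diff_theta in auto)
  have "(\<lambda>\<sigma>. indicator {0<..} \<sigma> * deriv (F_sigma f n x 0) \<sigma>) \<in> borel_measurable borel"
    by (rule borel_measurable_deriv_on) (use diff_sigma in auto)
  then have 2: "(\<lambda>p. indicator {0<..} (fst p) * deriv (F_sigma f n x 0) (fst p)) \<in> borel_measurable (borel :: (real \<times> real) measure)"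
    by (rule measurable_compose[rotated]) (auto intro!: borel_measurable_continuous_onI continuous_intros)
  have "(\<lambda>p. \<bar>indicator {0<..} (fst p) * deriv (F_sigma f n x 0) (fst p)\<bar>
      * \<bar>case p of (\<sigma>, \<theta>) \<Rightarrow> indicator ({0<..} \<times> UNIV) (\<sigma>, \<theta>) * deriv (F_theta f n x \<sigma>) \<theta>\<bar>) \<in> borel_measurable borel"
    by (rule borel_measurable_times[OF borel_measurable_abs[OF 2] borel_measurable_abs[OF 1]])
  moreover have "(\<lambda>p. \<bar>indicator {0<..} (fst p) * deriv (F_sigma f n x 0) (fst p)\<bar>
      * \<bar>case p of (\<sigma>, \<theta>) \<Rightarrow> indicator ({0<..} \<times> UNIV) (\<sigma>, \<theta>) * deriv (F_theta f n x \<sigma>) \<theta>\<bar>)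
    = (\<lambda>(\<sigma>, \<theta>). indicator {0<..} \<sigma> * fiducial_density f n x \<sigma> \<theta>)"
    by (auto simp: fun_eq_iff fiducial_density_eq indicator_def)
  ultimately show ?thesis by simp
qed

text \<open>Fubini: a relation that holds for almost all \<open>\<theta>\<close>, for almost all \<open>\<sigma>\<close>, holds almost everywhere in
  the plane once both densities are jointly measurable.\<close>

lemma param_measure_scale_AE:
  assumes g: "(\<lambda>(\<sigma>, \<theta>). indicator {0<..} \<sigma> * g \<sigma> \<theta>) \<in> borel_measurable borel"
    and h: "(\<lambda>(\<sigma>, \<theta>). indicator {0<..} \<sigma> * h \<sigma> \<theta>) \<in> borel_measurable borel"
    and K: "0 \<le> K"
    and ae: "AE \<sigma> in lborel. 0 < \<sigma> \<longrightarrow> (AE \<theta> in lborel. g \<sigma> \<theta> = K * h \<sigma> \<theta>)"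
  shows "param_measure g = scale_measure (ennreal K) (param_measure h)"
proof -
  let ?g = "\<lambda>(\<sigma>::real, \<theta>::real). indicator {0<..} \<sigma> * ennreal (g \<sigma> \<theta>)"
  let ?h = "\<lambda>(\<sigma>::real, \<theta>::real). indicator {0<..} \<sigma> * ennreal (h \<sigma> \<theta>)"
  have eq: "(\<lambda>(\<sigma>::real, \<theta>::real). indicator {0<..} \<sigma> * ennreal (k \<sigma> \<theta>)) = (\<lambda>p. ennreal (case p of (\<sigma>, \<theta>) \<Rightarrow> indicator {0<..} \<sigma> * k \<sigma> \<theta>))"
    for k :: "real \<Rightarrow> real \<Rightarrow> real"
    by (auto simp: fun_eq_iff indicator_def)
  have g'[measurable]: "?g \<in> borel_measurable borel" and h'[measurable]: "?h \<in> borel_measurable borel"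
    unfolding eq using g h by (auto intro: measurable_compose[OF _ measurable_ennreal])
  have "AE p in lborel. ?g p = ennreal K * ?h p"
    unfolding lborel_prod[symmetric]
  proof (rule lborel_pair.AE_pair_measure)
    have [measurable]: "?g \<in> borel_measurable (borel \<Otimes>\<^sub>M borel)" "?h \<in> borel_measurable (borel \<Otimes>\<^sub>M borel)"
      using g' h' by (simp_all add: borel_prod)
    show "{p \<in> space (lborel \<Otimes>\<^sub>M lborel). ?g p = ennreal K * ?h p} \<in> sets (lborel \<Otimes>\<^sub>M lborel)"
      by measurable
    show "AE \<sigma> in lborel. AE \<theta> in lborel. ?g (\<sigma>, \<theta>) = ennreal K * ?h (\<sigma>, \<theta>)"
      using ae
    proof eventually_elim
      case (elim \<sigma>)
      show ?case
      proof (cases "0 < \<sigma>")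
        case True
        with elim have "AE \<theta> in lborel. g \<sigma> \<theta> = K * h \<sigma> \<theta>" by simp
        then show ?thesis by eventually_elim (use True in \<open>simp add: ennreal_mult' K\<close>)
      qed simp
    qed
  qed
  then have "param_measure g = density lborel (\<lambda>p. ennreal K * ?h p)"
    unfolding param_measure_def by (intro density_cong) auto
  also have "\<dots> = scale_measure (ennreal K) (param_measure h)"
  proof (rule measure_eqI)
    fix A assume "A \<in> sets (density lborel (\<lambda>p. ennreal K * ?h p))"
    then have [measurable]: "A \<in> sets borel" by simp
    show "emeasure (density lborel (\<lambda>p. ennreal K * ?h p)) A = emeasure (scale_measure (ennreal K) (param_measure h)) A"
      unfolding param_measure_def emeasure_scale_measure
      by (subst (1 2) emeasure_density) (auto simp: mult.assoc intro!: nn_integral_cmult)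
  qed (simp add: param_measure_def)
  finally show ?thesis .
qed

section \<open>Fiducial and posterior distributions\<close>

text \<open>Multiplying the two factors cancels the density of \<open>(Z\<^sub>2, Z)\<close> and leaves the joint density at
  the observed statistics, which is the likelihood up to the Jacobian \<open>\<bar>z2\<bar> ^ (n - 2)\<close>. What remains
  besides \<open>1 / \<sigma>\<close> and the likelihood depends on the data only.\<close>

lemma AE_fiducial_density:
  assumes f: "is_density f" and n: "2 \<le> n" and x: "x 1 \<noteq> x 2"
    and int: "integrable (lborel \<Otimes>\<^sub>M lborel) (\<lambda>(u, v). joint_density f n 0 1 u v (stat_Z n x))"
    and c: "0 < dens_Z f n 0 1 (stat_Z n x)"
    and diff_sigma: "\<And>\<sigma>. 0 < \<sigma> \<Longrightarrow> F_sigma f n x 0 differentiable (at \<sigma>)"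
    and diff_theta: "\<And>\<sigma> \<theta>. 0 < \<sigma> \<Longrightarrow> F_theta f n x \<sigma> differentiable (at \<theta>)"
  shows "AE \<sigma> in lborel. 0 < \<sigma> \<longrightarrow> (AE \<theta> in lborel. fiducial_density f n x \<sigma> \<theta> =
    \<bar>stat_Z2 x\<bar> ^ (n - 1) / dens_Z f n 0 1 (stat_Z n x) * (reference_prior \<sigma> \<theta> * likelihood f n \<theta> \<sigma> x))"
proof -
  let ?w = "stat_Z2 x" and ?z = "stat_Z n x"
  let ?c = "dens_Z f n 0 1 ?z"
  have w: "?w \<noteq> 0" using x by (simp add: stat_Z2_def)
  have m_int: "integrable lborel (\<lambda>v. dens_Z2_Z f n 0 1 v ?z)"
    unfolding dens_Z2_Z_def by (rule lborel_pair.integrable_snd[OF int])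
  have "AE v in lborel. integrable lborel (\<lambda>u. joint_density f n 0 1 u v ?z)"
    by (rule lborel_pair.AE_integrable_snd[OF int])
  \<comment> \<open>Only almost every section of the joint density is integrable, and the null set of exceptions
    in \<open>v\<close> stays null under \<open>v = z2 / \<sigma>\<close>.\<close>
  then have sections: "AE \<sigma> in lborel. \<sigma> \<in> {0<..} \<longrightarrow> integrable lborel (\<lambda>u. joint_density f n 0 1 u (?w / \<sigma>) ?z)"
  proof (rule AE_lborel_transport[where \<psi> = "\<lambda>y. ?w / y"])
    show "(\<lambda>y. ?w / y) differentiable_on (\<lambda>\<sigma>. ?w / \<sigma>) ` {0<..}"
      using w by (auto intro!: derivative_intros simp: differentiable_on_def)
  qed (use w in simp)
  have "AE \<sigma> in lborel. 0 < \<sigma> \<longrightarrow> \<bar>deriv (F_sigma f n x 0) \<sigma>\<bar>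
      = \<bar>?w\<bar> / (\<sigma> * ?c) * dens_Z2_Z f n 0 \<sigma> ?w ?z"
    by (rule AE_abs_deriv_F_sigma[OF f n w m_int c diff_sigma])
  with sections show ?thesis
  proof eventually_elim
    case (elim \<sigma>)
    show ?case
    proof
      assume \<sigma>: "0 < \<sigma>"
      have "AE \<theta> in lborel. dens_Z2_Z f n \<theta> \<sigma> ?w ?z * \<bar>deriv (F_theta f n x \<sigma>) \<theta>\<bar> = joint_density f n \<theta> \<sigma> (x 1) ?w ?z"
        by (rule AE_abs_deriv_F_theta[OF f n \<sigma>]) (use elim \<sigma> diff_theta in auto)
      then show "AE \<theta> in lborel. fiducial_density f n x \<sigma> \<theta> =
          \<bar>?w\<bar> ^ (n - 1) / ?c * (reference_prior \<sigma> \<theta> * likelihood f n \<theta> \<sigma> x)"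
      proof eventually_elim
        case (elim \<theta>)
        have "fiducial_density f n x \<sigma> \<theta> = \<bar>deriv (F_sigma f n x 0) \<sigma>\<bar> * \<bar>deriv (F_theta f n x \<sigma>) \<theta>\<bar>"
          by (rule fiducial_density_eq)
        also have "\<dots> = \<bar>?w\<bar> / (\<sigma> * ?c) * (dens_Z2_Z f n \<theta> \<sigma> ?w ?z * \<bar>deriv (F_theta f n x \<sigma>) \<theta>\<bar>)"
          using \<open>0 < \<sigma> \<longrightarrow> \<bar>deriv (F_sigma f n x 0) \<sigma>\<bar> = _\<close> \<sigma>
          by (simp add: dens_Z2_Z_location_free[of f n \<theta>])
        also have "\<dots> = \<bar>?w\<bar> / (\<sigma> * ?c) * (\<bar>?w\<bar> ^ (n - 2) * likelihood f n \<theta> \<sigma> x)"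
          unfolding elim joint_density_at_sample[where x=x, OF n x] ..
        also have "\<dots> = \<bar>?w\<bar> ^ Suc (n - 2) / ?c * (reference_prior \<sigma> \<theta> * likelihood f n \<theta> \<sigma> x)"
          by (simp add: reference_prior_def mult_ac)
        also have "Suc (n - 2) = n - 1" using n by simp
        finally show ?case .
      qed
    qed
  qed
qed

text \<open>Integrating out \<open>\<theta>\<close> first gives 1 for every \<open>\<sigma>\<close>, and then the integral over \<open>\<sigma>\<close> is 1 too: each
  step contributes the total variation of a distribution function in its parameter.\<close>

lemma emeasure_param_measure_fiducial_density:
  assumes f: "is_density f"
    and mon_sigma: "monotone_differentiable_on {0<..} (F_sigma f n x 0)"
    and mon_theta: "\<And>\<sigma>. 0 < \<sigma> \<Longrightarrow> monotone_differentiable_on UNIV (F_theta f n x \<sigma>)"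
    and lim_sigma: "limits_zero_one (at_right 0) at_top (F_sigma f n x 0)"
    and lim_theta: "\<And>\<sigma>. 0 < \<sigma> \<Longrightarrow> limits_zero_one at_bot at_top (F_theta f n x \<sigma>)"
  shows "emeasure (param_measure (fiducial_density f n x)) UNIV = 1"
proof -
  let ?h = "\<lambda>(\<sigma>::real, \<theta>). indicator {0<..} \<sigma> * ennreal (fiducial_density f n x \<sigma> \<theta>)"
  have eq: "?h = (\<lambda>p. ennreal (case p of (\<sigma>, \<theta>) \<Rightarrow> indicator {0<..} \<sigma> * fiducial_density f n x \<sigma> \<theta>))"
    by (auto simp: fun_eq_iff indicator_def)
  have h: "?h \<in> borel_measurable borel"
    unfolding eq by (rule measurable_compose[OF borel_measurable_fiducial_density[OF f] measurable_ennreal])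
      (use mon_sigma mon_theta in \<open>auto simp: monotone_differentiable_on_def\<close>)
  have theta: "(\<integral>\<^sup>+\<theta>. ennreal \<bar>deriv (F_theta f n x \<sigma>) \<theta>\<bar> \<partial>lborel) = 1" if "0 < \<sigma>" for \<sigma>
  proof -
    have cover: "UNIV = (\<Union>k. {- real k..real k})"
    proof -
      have "\<exists>k. t \<in> {- real k..real k}" for t :: real
      proof -
        obtain k where "\<bar>t\<bar> \<le> real k" using real_arch_simple by blast
        then have "t \<in> {- real k..real k}" by (simp add: abs_le_iff)
        then show ?thesis ..
      qed
      then show ?thesis by blast
    qed
    have "(\<integral>\<^sup>+\<theta>. ennreal \<bar>deriv (F_theta f n x \<sigma>) \<theta>\<bar> * indicator UNIV \<theta> \<partial>lborel) = 1"
      by (rule nn_integral_abs_deriv_eq_1[OF mon_theta[OF that] lim_theta[OF that] open_UNIV cover])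
         (auto simp: decseq_def incseq_def filterlim_uminus_at_bot filterlim_real_sequentially)
    then show ?thesis by simp
  qed
  have sigma: "(\<integral>\<^sup>+\<sigma>. ennreal \<bar>deriv (F_sigma f n x 0) \<sigma>\<bar> * indicator {0<..} \<sigma> \<partial>lborel) = 1"
  proof (rule nn_integral_abs_deriv_eq_1[OF mon_sigma lim_sigma])
    let ?a = "\<lambda>k. inverse (real (Suc k))" and ?b = "\<lambda>k. real (Suc k)"
    show "{0<..} = (\<Union>k. {?a k..?b k})"
    proof (intro equalityI subsetI)
      fix t :: real assume "t \<in> {0<..}"
      then have t: "0 < t" by simp
      obtain k1 where k1: "inverse (real (Suc k1)) < t" using reals_Archimedean[OF t] by blast
      obtain k2 where k2: "t \<le> real k2" using real_arch_simple by blast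
      have "?a (max k1 k2) \<le> ?a k1" by (intro le_imp_inverse_le) auto
      then have "?a (max k1 k2) \<le> t" using k1 by linarith
      moreover have "t \<le> ?b (max k1 k2)" using k2 by simp
      ultimately have "t \<in> {?a (max k1 k2)..?b (max k1 k2)}" unfolding atLeastAtMost_iff ..
      then show "t \<in> (\<Union>k. {?a k..?b k})" by blast
    next
      fix t assume "t \<in> (\<Union>k. {?a k..?b k})"
      then obtain k where "?a k \<le> t" by auto
      moreover have "0 < ?a k" by simp
      ultimately show "t \<in> {0<..}" unfolding greaterThan_iff by linarith
    qed
    show "decseq ?a" by (auto simp: decseq_def intro!: le_imp_inverse_le)
    show "?a k \<le> ?b k" for k
      by (rule order_trans[of _ 1]) (simp_all add: inverse_le_1_iff)
    show "filterlim ?a (at_right 0) sequentially"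
      using LIMSEQ_inverse_real_of_nat by (auto simp: filterlim_at)
    show "filterlim ?b at_top sequentially"
      using filterlim_compose[OF filterlim_real_sequentially filterlim_Suc] by simp
  qed (auto simp: incseq_def)
  have "emeasure (param_measure (fiducial_density f n x)) UNIV = (\<integral>\<^sup>+p. ?h p \<partial>lborel)"
    unfolding param_measure_def using h by (subst emeasure_density) auto
  also have "\<dots> = (\<integral>\<^sup>+\<sigma>. \<integral>\<^sup>+\<theta>. ?h (\<sigma>, \<theta>) \<partial>lborel \<partial>lborel)"
  proof -
    have "?h \<in> borel_measurable (lborel \<Otimes>\<^sub>M lborel)"
      using h by (simp only: lborel_prod measurable_lborel2)
    from lborel.nn_integral_fst[OF this] show ?thesis by (simp only: lborel_prod)
  qed
  also have "\<dots> = (\<integral>\<^sup>+\<sigma>. ennreal \<bar>deriv (F_sigma f n x 0) \<sigma>\<bar> * indicator {0<..} \<sigma> \<partial>lborel)"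
  proof (rule nn_integral_cong)
    fix \<sigma> :: real
    show "(\<integral>\<^sup>+\<theta>. ?h (\<sigma>, \<theta>) \<partial>lborel) = ennreal \<bar>deriv (F_sigma f n x 0) \<sigma>\<bar> * indicator {0<..} \<sigma>"
    proof (cases "0 < \<sigma>")
      case True
      have "(\<lambda>\<theta>. indicator UNIV \<theta> * deriv (F_theta f n x \<sigma>) \<theta>) \<in> borel_measurable borel"
        by (rule borel_measurable_deriv_on)
           (use mon_theta[OF True] in \<open>auto simp: monotone_differentiable_on_def\<close>)
      then have [measurable]: "deriv (F_theta f n x \<sigma>) \<in> borel_measurable borel" by simp
      have "(\<integral>\<^sup>+\<theta>. ?h (\<sigma>, \<theta>) \<partial>lborel)
          = (\<integral>\<^sup>+\<theta>. ennreal \<bar>deriv (F_sigma f n x 0) \<sigma>\<bar> * ennreal \<bar>deriv (F_theta f n x \<sigma>) \<theta>\<bar> \<partial>lborel)"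
        using True by (simp add: fiducial_density_eq ennreal_mult)
      also have "\<dots> = ennreal \<bar>deriv (F_sigma f n x 0) \<sigma>\<bar>"
        by (subst nn_integral_cmult) (simp_all add: theta[OF True])
      finally show ?thesis using True by simp
    qed simp
  qed
  finally show ?thesis using sigma by simp
qed

theorem proposition9:
  fixes f :: "real \<Rightarrow> real" and n :: nat and x :: "nat \<Rightarrow> real"
  assumes f: "is_density f"
    and n: "2 \<le> n"
    and Z_defined: "x 1 \<noteq> x 2"
    and cond_defined: "\<And>\<theta> \<sigma>. 0 < \<sigma> \<Longrightarrow>
          integrable (lborel \<Otimes>\<^sub>M lborel)
            (\<lambda>(x1, z2). joint_density f n \<theta> \<sigma> x1 z2 (stat_Z n x)) \<and>
          0 < dens_Z f n \<theta> \<sigma> (stat_Z n x)"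
    and reg_sigma: "\<And>\<theta>. monotone_differentiable_on {0<..} (\<lambda>\<sigma>. F_sigma f n x \<theta> \<sigma>)"
    and reg_theta: "\<And>\<sigma>. 0 < \<sigma> \<Longrightarrow> monotone_differentiable_on UNIV (\<lambda>\<theta>. F_theta f n x \<sigma> \<theta>)"
  shows "fiducial_distribution f n x = reference_posterior f n x \<and>
    ((\<forall>\<theta>. limits_zero_one (at_right 0) at_top (\<lambda>\<sigma>. F_sigma f n x \<theta> \<sigma>)) \<and>
     (\<forall>\<sigma>>0. limits_zero_one at_bot at_top (\<lambda>\<theta>. F_theta f n x \<sigma> \<theta>)) \<longrightarrow>
     param_measure (fiducial_density f n x) = reference_posterior f n x)"
proof -
  define K where "K = \<bar>stat_Z2 x\<bar> ^ (n - 1) / dens_Z f n 0 1 (stat_Z n x)"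
  have c: "0 < dens_Z f n 0 1 (stat_Z n x)" and
    int: "integrable (lborel \<Otimes>\<^sub>M lborel) (\<lambda>(u, v). joint_density f n 0 1 u v (stat_Z n x))"
    using cond_defined[of 1 0] by auto
  have K: "0 < K" using c Z_defined by (simp add: K_def stat_Z2_def)
  have diff_sigma: "F_sigma f n x 0 differentiable (at \<sigma>)" if "0 < \<sigma>" for \<sigma>
    using reg_sigma[of 0] that by (simp add: monotone_differentiable_on_def)
  have diff_theta: "F_theta f n x \<sigma> differentiable (at \<theta>)" if "0 < \<sigma>" for \<sigma> \<theta>
    using reg_theta[OF that] by (simp add: monotone_differentiable_on_def)
  have post_meas: "(\<lambda>(\<sigma>, \<theta>). indicator {0<..} \<sigma> * (reference_prior \<sigma> \<theta> * likelihood f n \<theta> \<sigma> x)) \<in> borel_measurable borel"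
  proof -
    have [measurable]: "(\<lambda>p. likelihood f n (snd p) (fst p) x) \<in> borel_measurable (borel \<Otimes>\<^sub>M borel)"
      by (rule borel_measurable_likelihood) (use f in \<open>auto simp: is_density_def\<close>)
    have "(\<lambda>p::real \<times> real. indicator {0<..} (fst p) * (reference_prior (fst p) (snd p) * likelihood f n (snd p) (fst p) x)) \<in> borel_measurable (borel \<Otimes>\<^sub>M borel)"
      unfolding reference_prior_def by measurable
    then show ?thesis by (simp add: borel_prod case_prod_beta)
  qed
  have scale: "param_measure (fiducial_density f n x) =
      scale_measure (ennreal K) (param_measure (\<lambda>\<sigma> \<theta>. reference_prior \<sigma> \<theta> * likelihood f n \<theta> \<sigma> x))"
    using AE_fiducial_density[OF f n Z_defined int c diff_sigma diff_theta] K
    by (intro param_measure_scale_AE borel_measurable_fiducial_density[OF f diff_sigma diff_theta] post_meas)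
       (auto simp: K_def)
  have eq: "fiducial_distribution f n x = reference_posterior f n x"
    unfolding fiducial_distribution_def reference_posterior_def scale
    by (rule normalize_scale_measure[OF K])
  moreover have "param_measure (fiducial_density f n x) = reference_posterior f n x"
    if "\<forall>\<theta>. limits_zero_one (at_right 0) at_top (\<lambda>\<sigma>. F_sigma f n x \<theta> \<sigma>)"
      "\<forall>\<sigma>>0. limits_zero_one at_bot at_top (\<lambda>\<theta>. F_theta f n x \<sigma> \<theta>)"
  proof -
    have "emeasure (param_measure (fiducial_density f n x)) UNIV = 1"
      by (rule emeasure_param_measure_fiducial_density[OF f reg_sigma reg_theta]) (use that in auto)
    then have "fiducial_distribution f n x = param_measure (fiducial_density f n x)"
      unfolding fiducial_distribution_def
      by (intro normalize_measure_prob) (simp add: param_measure_def)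
    with eq show ?thesis by simp
  qed
  ultimately show ?thesis by blast
qed

end
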